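(* Let $\Phi$ be a root system of type $A_4$, $B_4$, $D_4$, $F_4$ or $H_4$ in 4-dimensional Euclidean space, with simple roots normalised to unit length, and let $W$ be its Coxeter versor, the product in $\mathrm{Cl}(4)$ of the four simple roots. Let $B_C$ be the unit bivector of the Coxeter plane and $I=e_1e_2e_3e_4$, so that $IB_C$ is the unit bivector of the orthogonal plane. Then, up to an overall sign and signs in the exponents (depending on the order in which the simple roots are multiplied and on the orientations of the planes), $W$ factorises as follows, where $h$ denotes the Coxeter number: \begin{itemize} \item $A_4$ ($h=5$, exponents $1,2,3,4$): $W=\exp\left(\frac{\pi}{5}B_C\right)\exp\left(\frac{2\pi}{5}IB_C\right)$; \item $B_4$ ($h=8$, exponents $1,3,5,7$): $W=\exp\left(\frac{\pi}{8}B_C\right)\exp\left(\frac{3\pi}{8}IB_C\right)$; \item $D_4$ ($h=6$, exponents $1,3,3,5$): $W=\exp\left(\frac{\pi}{6}B_C\right)\exp\left(\frac{\pi}{2}IB_C\right)$; \item $F_4$ ($h=12$, exponents $1,5,7,11$): $W=\exp\left(\frac{\pi}{12}B_C\right)\exp\left(\frac{5\pi}{12}IB_C\right)$; \item $H_4$ ($h=30$, exponents $1,11,19,29$): $W=\exp\left(\frac{\pi}{30}B_C\right)\exp\left(\frac{11\pi}{30}IB_C\right)$. \end{itemize}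
   Context: $\mathrm{Cl}(4)$ is the real Clifford algebra generated by orthonormal vectors $e_1,\dots,e_4$ with $e_i^2=1$, $e_ie_j=-e_je_i$ for $i\ne j$. The tilde denotes reversal of the order of vector factors. The Coxeter element $w$ is the product of the simple reflections $s_\alpha v=-\alpha v\alpha$ and is given by $wv=\tilde WvW$. Its order is the Coxeter number $h$, and its complex eigenvalues are $\exp(2\pi i m/h)$, where the integers $m$ with $0<m<h$ (with multiplicity) are the exponents. The Coxeter plane is the plane on which $w$ acts as a rotation by $2\pi/h$. The unit bivector of a plane with orthonormal basis $u,v$ is $uv$ (squaring to $-1$), determined up to orientation. $\exp(\theta B)=\cos\theta+B\sin\theta$ for a unit bivector $B$. *)

theory Defs
  imports "HOL-Analysis.Analysis" "HOL-Computational_Algebra.Computational_Algebra"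
    "HOL-Library.Multiset"
begin

section \<open>The Clifford algebra of Euclidean space\<close>

text \<open>
  An element is given by its coefficients with respect to the basis blades: the blade of a set
  \<open>S\<close> of indices is the product of the generators \<open>e\<^sub>i\<close> (\<open>i \<in> S\<close>), in increasing order of \<open>i\<close>.
  Sorting the product of the blades of \<open>S\<close> and \<open>T\<close> costs one sign for each pair \<open>i \<in> S\<close>, \<open>j \<in> T\<close>
  with \<open>j < i\<close>, after which equal neighbours cancel because \<open>e\<^sub>i\<^sup>2 = 1\<close>.
\<close>

typedef 'n clifford = "UNIV :: ('n set \<Rightarrow> real) set"
  morphisms blade_coeff Clifford
  by simp

lemma blade_coeff_Clifford [simp]: "blade_coeff (Clifford f) S = f S"
  by (simp add: Clifford_inverse)

lemma clifford_eqI: "(\<And>S. blade_coeff x S = blade_coeff y S) \<Longrightarrow> x = y"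
  by (metis blade_coeff_inject ext)

definition blade_sign :: "'n::{finite,linorder} set \<Rightarrow> 'n set \<Rightarrow> real" where
  "blade_sign S T = (\<Prod>i\<in>S. \<Prod>j\<in>T. if j < i then - 1 else 1)"

lemma prod_sym_diff:
  fixes f :: "'n::finite \<Rightarrow> real"
  assumes "\<And>i. f i * f i = 1"
  shows "prod f (sym_diff S T) = prod f S * prod f T"
proof -
  have S: "prod f S = prod f (S - T) * prod f (S \<inter> T)"
    by (subst prod.union_disjoint [symmetric]) (auto intro: prod.cong)
  have T: "prod f T = prod f (T - S) * prod f (S \<inter> T)"
    by (subst prod.union_disjoint [symmetric]) (auto intro: prod.cong)
  have 1: "prod f (S \<inter> T) * prod f (S \<inter> T) = 1"
    by (simp add: prod.distrib [symmetric] assms)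
  have "prod f (sym_diff S T) = prod f (S - T) * prod f (T - S)"
    by (rule prod.union_disjoint) auto
  also have "\<dots> = prod f (S - T) * prod f (T - S) * (prod f (S \<inter> T) * prod f (S \<inter> T))"
    by (simp add: 1)
  finally show ?thesis
    by (simp add: S T)
qed

lemma blade_sign_left: "blade_sign (sym_diff A B) C = blade_sign A C * blade_sign B C"
  unfolding blade_sign_def by (rule prod_sym_diff) (auto simp: prod.distrib [symmetric] intro!: prod.neutral)

lemma blade_sign_right: "blade_sign A (sym_diff B C) = blade_sign A B * blade_sign A C"
  unfolding blade_sign_def by (subst prod_sym_diff) (auto simp: prod.distrib)

lemma blade_sign_empty [simp]: "blade_sign {} S = 1" "blade_sign S {} = 1"
  by (simp_all add: blade_sign_def)

lemma abs_blade_sign [simp]: "\<bar>blade_sign S T\<bar> = 1"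
  by (auto simp: blade_sign_def abs_prod intro!: prod.neutral)

lemma sym_diff_cancel: "sym_diff S (sym_diff S T) = T"
  by auto

lemma sum_sym_diff:
  fixes f :: "'n::finite set \<Rightarrow> real"
  shows "(\<Sum>S\<in>UNIV. f (sym_diff T S)) = (\<Sum>S\<in>UNIV. f S)"
  by (rule sum.reindex_bij_witness [of _ "sym_diff T" "sym_diff T"])
     (auto simp: sym_diff_cancel)

instantiation clifford :: (type) real_vector
begin
definition "0 = Clifford (\<lambda>S. 0)"
definition "x + y = Clifford (\<lambda>S. blade_coeff x S + blade_coeff y S)"
definition "x - y = Clifford (\<lambda>S. blade_coeff x S - blade_coeff y S)"
definition "- x = Clifford (\<lambda>S. - blade_coeff x S)"
definition "r *\<^sub>R x = Clifford (\<lambda>S. r * blade_coeff x S)"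
instance
  by standard
    (auto intro!: clifford_eqI simp: zero_clifford_def plus_clifford_def minus_clifford_def
       uminus_clifford_def scaleR_clifford_def algebra_simps)
end

lemma blade_coeff_simps [simp]:
  "blade_coeff 0 S = 0"
  "blade_coeff (x + y) S = blade_coeff x S + blade_coeff y S"
  "blade_coeff (x - y) S = blade_coeff x S - blade_coeff y S"
  "blade_coeff (- x) S = - blade_coeff x S"
  "blade_coeff (r *\<^sub>R x) S = r * blade_coeff x S"
  by (simp_all add: zero_clifford_def plus_clifford_def minus_clifford_def
       uminus_clifford_def scaleR_clifford_def)

lemma blade_coeff_sum [simp]: "blade_coeff (sum f A) S = (\<Sum>a\<in>A. blade_coeff (f a) S)"
  by (induction A rule: infinite_finite_induct) auto

instantiation clifford :: ("{finite,linorder}") real_algebra_1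
begin
definition "1 = Clifford (\<lambda>S. if S = {} then 1 else 0)"
definition "x * y = Clifford (\<lambda>U. \<Sum>S\<in>UNIV.
   blade_sign S (sym_diff S U) * blade_coeff x S * blade_coeff y (sym_diff S U))"
instance
proof
  fix x y z :: "'a clifford" and r :: real
  let ?c = "blade_coeff :: 'a clifford \<Rightarrow> _"
  show "x * y * z = x * (y * z)"
  proof (rule clifford_eqI)
    fix U :: "'a set"
    have *: "blade_sign S (sym_diff S U) * blade_sign T (sym_diff T S)
      = blade_sign T (sym_diff T U) * blade_sign (sym_diff T S) (sym_diff S U)" for S T
    proof -
      have 1: "S = sym_diff T (sym_diff T S)" "sym_diff T U = sym_diff (sym_diff T S) (sym_diff S U)"
        by auto
      have "blade_sign S (sym_diff S U)
          = blade_sign T (sym_diff S U) * blade_sign (sym_diff T S) (sym_diff S U)"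
        by (metis 1(1) blade_sign_left)
      moreover have "blade_sign T (sym_diff T U)
          = blade_sign T (sym_diff T S) * blade_sign T (sym_diff S U)"
        by (metis 1(2) blade_sign_right)
      ultimately show ?thesis by simp
    qed
    have "?c (x * y * z) U = (\<Sum>S\<in>UNIV. \<Sum>T\<in>UNIV.
        (blade_sign S (sym_diff S U) * blade_sign T (sym_diff T S))
          * ?c x T * ?c y (sym_diff T S) * ?c z (sym_diff S U))"
      by (simp add: times_clifford_def sum_distrib_left sum_distrib_right mult_ac)
    also have "\<dots> = (\<Sum>T\<in>UNIV. \<Sum>S\<in>UNIV.
        (blade_sign T (sym_diff T U) * blade_sign (sym_diff T S) (sym_diff S U))
          * ?c x T * ?c y (sym_diff T S) * ?c z (sym_diff S U))"
      unfolding * by (rule sum.swap)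
    also have "\<dots> = (\<Sum>T\<in>UNIV. \<Sum>R\<in>UNIV.
        (blade_sign T (sym_diff T U) * blade_sign R (sym_diff R (sym_diff T U)))
          * ?c x T * ?c y R * ?c z (sym_diff R (sym_diff T U)))"
    proof (rule sum.cong [OF refl])
      fix T
      have 2: "sym_diff S U = sym_diff (sym_diff T S) (sym_diff T U)" for S
        by auto
      show "(\<Sum>S\<in>UNIV.
        (blade_sign T (sym_diff T U) * blade_sign (sym_diff T S) (sym_diff S U))
          * ?c x T * ?c y (sym_diff T S) * ?c z (sym_diff S U)) = (\<Sum>R\<in>UNIV.
        (blade_sign T (sym_diff T U) * blade_sign R (sym_diff R (sym_diff T U)))
          * ?c x T * ?c y R * ?c z (sym_diff R (sym_diff T U)))"
        by (subst 2, subst 2)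
          (rule sum_sym_diff [of "\<lambda>R. (blade_sign T (sym_diff T U) * blade_sign R (sym_diff R (sym_diff T U)))
          * ?c x T * ?c y R * ?c z (sym_diff R (sym_diff T U))"])
    qed
    also have "\<dots> = ?c (x * (y * z)) U"
      by (simp add: times_clifford_def sum_distrib_left sum_distrib_right mult_ac)
    finally show "?c (x * y * z) U = ?c (x * (y * z)) U" .
  qed
  show "1 * x = x"
    by (rule clifford_eqI)
      (simp add: times_clifford_def one_clifford_def if_distrib [of "\<lambda>t. _ * t"]
        if_distrib [of "\<lambda>t. t * _"] cong: if_cong)
  show "x * 1 = x"
  proof (rule clifford_eqI)
    fix U :: "'a set"
    have eq: "sym_diff S U = {} \<longleftrightarrow> S = U" for S by auto
    show "?c (x * 1) U = ?c x U"
      unfolding times_clifford_def one_clifford_def blade_coeff_Clifford eq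
      by (simp add: if_distrib [of "\<lambda>t. _ * t"] cong: if_cong)
  qed
  show "(0::'a clifford) \<noteq> 1"
  proof
    assume "(0::'a clifford) = 1"
    hence "?c 0 {} = ?c 1 {}" by simp
    thus False by (simp add: one_clifford_def)
  qed
qed (auto intro!: clifford_eqI sum.cong simp: times_clifford_def algebra_simps sum.distrib sum_distrib_left)
end

text \<open>
  The norm is the \<open>\<ell>\<^sup>1\<close>-norm of the coefficients. Only the topology it induces is used,
  to make the library's exponential series available.
\<close>

instantiation clifford :: ("{finite,linorder}") real_normed_algebra_1
begin
definition norm_clifford :: "'a clifford \<Rightarrow> real"
  where "norm_clifford x = (\<Sum>S\<in>UNIV. \<bar>blade_coeff x S\<bar>)"
definition dist_clifford :: "'a clifford \<Rightarrow> 'a clifford \<Rightarrow> real"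
  where "dist_clifford x y = norm (x - y)"
definition sgn_clifford :: "'a clifford \<Rightarrow> 'a clifford"
  where "sgn_clifford x = inverse (norm x) *\<^sub>R x"
definition uniformity_clifford :: "('a clifford \<times> 'a clifford) filter"
  where "uniformity_clifford = (INF e\<in>{0<..}. principal {(x, y). dist x y < e})"
definition open_clifford :: "'a clifford set \<Rightarrow> bool"
  where "open_clifford U = (\<forall>x\<in>U. \<forall>\<^sub>F (x', y) in uniformity. x' = x \<longrightarrow> y \<in> U)"
instance
proof
  fix x y :: "'a clifford" and r :: real
  show "norm x = 0 \<longleftrightarrow> x = 0"
    by (auto simp: norm_clifford_def sum_nonneg_eq_0_iff intro: clifford_eqI)
  show "norm (x + y) \<le> norm x + norm y"
    by (auto simp: norm_clifford_def sum.distrib [symmetric] intro!: sum_mono)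
  show "norm (r *\<^sub>R x) = \<bar>r\<bar> * norm x"
    by (simp add: norm_clifford_def abs_mult sum_distrib_left)
  show "norm (1::'a clifford) = 1"
    by (simp add: norm_clifford_def one_clifford_def if_distrib [of abs] cong: if_cong)
  have "norm (x * y) \<le> (\<Sum>U\<in>UNIV. \<Sum>S\<in>UNIV. \<bar>blade_coeff x S\<bar> * \<bar>blade_coeff y (sym_diff S U)\<bar>)"
    unfolding norm_clifford_def times_clifford_def blade_coeff_Clifford
    by (intro sum_mono order_trans [OF sum_abs]) (simp add: abs_mult)
  also have "\<dots> = (\<Sum>S\<in>UNIV. \<bar>blade_coeff x S\<bar> * (\<Sum>U\<in>UNIV. \<bar>blade_coeff y (sym_diff S U)\<bar>))"
    by (subst sum.swap) (simp only: sum_distrib_left)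
  also have "\<dots> = (\<Sum>S\<in>UNIV. \<bar>blade_coeff x S\<bar> * (\<Sum>U\<in>UNIV. \<bar>blade_coeff y U\<bar>))"
    by (subst sum_sym_diff [of "\<lambda>U. \<bar>blade_coeff y U\<bar>"]) (rule refl)
  finally show "norm (x * y) \<le> norm x * norm y"
    by (simp add: norm_clifford_def sum_distrib_right)
qed (simp_all add: dist_clifford_def sgn_clifford_def uniformity_clifford_def open_clifford_def)
end

instance clifford :: ("{finite,linorder}") banach
proof
  fix X :: "nat \<Rightarrow> 'a clifford"
  assume X: "Cauchy X"
  have le: "\<bar>blade_coeff x S\<bar> \<le> norm x" for x :: "'a clifford" and S
    unfolding norm_clifford_def by (rule member_le_sum) auto
  have "Cauchy (\<lambda>n. blade_coeff (X n) S)" for S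
  proof (rule CauchyI)
    fix e :: real assume "e > 0"
    with X obtain M where M: "\<forall>m\<ge>M. \<forall>n\<ge>M. norm (X m - X n) < e"
      using Cauchy_iff by blast
    show "\<exists>M. \<forall>m\<ge>M. \<forall>n\<ge>M. norm (blade_coeff (X m) S - blade_coeff (X n) S) < e"
    proof (intro exI [of _ M] allI impI)
      fix m n assume "M \<le> m" "M \<le> n"
      with M have "norm (X m - X n) < e" by blast
      with le [of "X m - X n" S] show "norm (blade_coeff (X m) S - blade_coeff (X n) S) < e"
        by simp
    qed
  qed
  hence "\<forall>S. \<exists>l. (\<lambda>n. blade_coeff (X n) S) \<longlonglongrightarrow> l"
    using real_Cauchy_convergent convergent_def by blast
  then obtain l where l: "\<And>S. (\<lambda>n. blade_coeff (X n) S) \<longlonglongrightarrow> l S"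
    by metis
  have "(\<lambda>n. norm (X n - Clifford l)) \<longlonglongrightarrow> (\<Sum>S\<in>(UNIV::'a set set). \<bar>l S - l S\<bar>)"
    unfolding norm_clifford_def by (simp only: blade_coeff_simps blade_coeff_Clifford) (intro tendsto_intros l)
  hence "X \<longlonglongrightarrow> Clifford l"
    using Lim_null tendsto_norm_zero_iff by fastforce
  thus "convergent X"
    by (rule convergentI)
qed

definition gen :: "'n::{finite,linorder} \<Rightarrow> 'n clifford" where
  "gen i = Clifford (\<lambda>S. if S = {i} then 1 else 0)"

definition cvec :: "real ^ 'n::{finite,linorder} \<Rightarrow> 'n clifford" where
  "cvec v = (\<Sum>i\<in>UNIV. v $ i *\<^sub>R gen i)"

text \<open>In the type \<open>4\<close> of integers modulo \<open>4\<close>, the index \<open>4\<close> is the same as \<open>0\<close>.\<close>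

definition pseudoscalar :: "4 clifford" where
  "pseudoscalar = gen 1 * gen 2 * gen 3 * gen 4"

lemma blade_mult:
  "Clifford (\<lambda>R. if R = S then 1 else 0) * Clifford (\<lambda>R. if R = T then 1 else 0)
   = blade_sign S T *\<^sub>R Clifford (\<lambda>R. if R = sym_diff S T then 1 else 0)"
proof (rule clifford_eqI)
  fix U
  have eq: "sym_diff S U = T \<longleftrightarrow> U = sym_diff S T" by auto
  have "blade_coeff (Clifford (\<lambda>R. if R = S then 1 else 0) * Clifford (\<lambda>R. if R = T then 1 else 0)) U
    = (if sym_diff S U = T then blade_sign S (sym_diff S U) else 0)"
  proof -
    have "blade_coeff (Clifford (\<lambda>R. if R = S then 1 else 0) * Clifford (\<lambda>R. if R = T then 1 else 0)) U
      = (\<Sum>S'\<in>UNIV. if S' = S then if sym_diff S U = T then blade_sign S (sym_diff S U) else 0 else 0)"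
      unfolding times_clifford_def blade_coeff_Clifford by (rule sum.cong) auto
    thus ?thesis by simp
  qed
  also have "\<dots> = (if U = sym_diff S T then blade_sign S T else 0)"
    by (metis eq)
  finally show "blade_coeff (Clifford (\<lambda>R. if R = S then 1 else 0) * Clifford (\<lambda>R. if R = T then 1 else 0)) U
    = blade_coeff (blade_sign S T *\<^sub>R Clifford (\<lambda>R. if R = sym_diff S T then 1 else 0)) U"
    by simp
qed

lemma gen_square: "gen i * gen i = 1"
  by (simp add: gen_def blade_mult blade_sign_def one_clifford_def)

lemma gen_anticommute: "i \<noteq> j \<Longrightarrow> gen i * gen j = - (gen j * gen i)"
  by (rule clifford_eqI) (auto simp: gen_def blade_mult blade_sign_def)

lemma gen_blade:
  fixes i :: "'n::{finite,linorder}"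
  assumes "\<And>j. j \<in> S \<Longrightarrow> i < j"
  shows "Clifford (\<lambda>R. if R = insert i S then 1 else 0) = gen i * Clifford (\<lambda>R. if R = S then 1 else 0)"
proof -
  have "sym_diff {i} S = insert i S" "blade_sign {i} S = 1"
    using assms by (force, auto simp: blade_sign_def not_less_iff_gr_or_eq intro!: prod.neutral)
  thus ?thesis
    unfolding gen_def blade_mult by simp
qed

lemma cvec_axis: "cvec (axis i 1) = gen i"
  by (simp add: cvec_def axis_def if_distrib [of "\<lambda>t. t *\<^sub>R _"] cong: if_cong)

lemma linear_cvec: "linear cvec"
  by (rule linearI) (simp_all add: cvec_def algebra_simps sum.distrib scaleR_sum_right)

lemma inj_cvec: "inj cvec"
proof (rule injI)
  fix v w :: "real ^ 'n::{finite,linorder}"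
  have c: "blade_coeff (cvec x) {i} = x $ i" for x :: "real ^ 'n::{finite,linorder}" and i
    by (simp add: cvec_def gen_def if_distrib [of "\<lambda>t. _ * t"] cong: if_cong)
  assume "cvec v = cvec w"
  thus "v = w" by (metis c vec_eq_iff)
qed

lemma cvec_anticommutator:
  "cvec v * cvec w + cvec w * cvec v = (2 * (v \<bullet> w)) *\<^sub>R 1"
proof -
  have g: "gen i * gen j + gen j * gen i = (if i = j then 2 *\<^sub>R 1 else 0)" for i j :: 'a
    using gen_anticommute [of i j] by (simp add: gen_square scaleR_2)
  have 1: "cvec v * cvec w = (\<Sum>i\<in>UNIV. \<Sum>j\<in>UNIV. (v $ i * w $ j) *\<^sub>R (gen i * gen j))"
    by (simp add: cvec_def sum_product mult_ac)
  have 2: "cvec w * cvec v = (\<Sum>i\<in>UNIV. \<Sum>j\<in>UNIV. (v $ i * w $ j) *\<^sub>R (gen j * gen i))"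
    by (simp add: cvec_def sum_product mult_ac) (rule sum.swap)
  have "cvec v * cvec w + cvec w * cvec v
      = (\<Sum>i\<in>UNIV. \<Sum>j\<in>UNIV. (v $ i * w $ j) *\<^sub>R (gen i * gen j + gen j * gen i))"
    unfolding 1 2 by (simp add: sum.distrib scaleR_add_right)
  also have "\<dots> = (\<Sum>i\<in>UNIV. (v $ i * w $ i) *\<^sub>R 2 *\<^sub>R 1)"
    unfolding g by (simp add: if_distrib [of "\<lambda>t. _ *\<^sub>R t"] cong: if_cong)
  finally show ?thesis
    by (simp add: inner_vec_def scaleR_sum_left sum_distrib_left mult_ac)
qed

lemma cvec_square: "cvec v * cvec v = (v \<bullet> v) *\<^sub>R 1"
proof -
  have "2 *\<^sub>R (cvec v * cvec v) = 2 *\<^sub>R ((v \<bullet> v) *\<^sub>R 1)"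
    using cvec_anticommutator [of v v] by (simp add: scaleR_2)
  thus ?thesis by (metis scaleR_cancel_left zero_neq_numeral)
qed

lemma exp_imaginary_unit:
  fixes B :: "'a::{real_normed_algebra_1,banach}"
  assumes "B * B = - 1"
  shows "exp (\<theta> *\<^sub>R B) = cos \<theta> *\<^sub>R 1 + sin \<theta> *\<^sub>R B"
proof -
  define f where "f z = Re z *\<^sub>R 1 + Im z *\<^sub>R B" for z
  have bl: "bounded_linear f"
    unfolding f_def
    by (intro bounded_linear_add bounded_linear_scaleR_const bounded_linear_Re bounded_linear_Im)
  have mult: "f (z * w) = f z * f w" for z w
    by (simp add: f_def algebra_simps assms)
  have one: "f 1 = 1" by (simp add: f_def)
  have pow: "f (z ^ n) = f z ^ n" for z n
    by (induction n) (simp_all add: mult one)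
  have "(\<lambda>n. f ((\<i> * \<theta>) ^ n /\<^sub>R fact n)) sums f (exp (\<i> * \<theta>))"
    by (rule bounded_linear.sums [OF bl exp_converges])
  hence "(\<lambda>n. f (\<i> * \<theta>) ^ n /\<^sub>R fact n) sums f (exp (\<i> * \<theta>))"
    by (simp add: linear_cmul [OF bounded_linear.linear [OF bl]] pow)
  hence "exp (f (\<i> * \<theta>)) = f (exp (\<i> * \<theta>))"
    using exp_converges sums_unique2 by blast
  moreover have "f (\<i> * \<theta>) = \<theta> *\<^sub>R B"
    by (simp add: f_def)
  moreover have "f (exp (\<i> * \<theta>)) = cos \<theta> *\<^sub>R 1 + sin \<theta> *\<^sub>R B"
    by (simp add: f_def Re_exp Im_exp)
  ultimately show ?thesis by simp
qed

section \<open>Root systems\<close>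

definition reflection :: "'a::euclidean_space \<Rightarrow> 'a \<Rightarrow> 'a" where
  "reflection a v = v - (2 * (a \<bullet> v) / (a \<bullet> a)) *\<^sub>R a"

lemma reflection_sgn: "reflection (sgn a) = reflection a"
proof (cases "a = 0")
  case False
  hence "norm a * norm a = a \<bullet> a" by (simp add: dot_square_norm power2_eq_square)
  with False show ?thesis
    by (auto simp: reflection_def sgn_div_norm fun_eq_iff divide_simps norm_eq_sqrt_inner)
qed simp

lemma cvec_reflection:
  assumes "norm a = 1"
  shows "cvec (reflection a v) = - (cvec a * cvec v * cvec a)"
proof -
  have aa: "a \<bullet> a = 1" using assms by (simp add: dot_square_norm)
  have "cvec a * cvec v = (2 * (a \<bullet> v)) *\<^sub>R 1 - cvec v * cvec a"
    using cvec_anticommutator [of a v] by (simp add: algebra_simps)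
  hence "cvec a * cvec v * cvec a = (2 * (a \<bullet> v)) *\<^sub>R cvec a - cvec v"
    by (simp add: left_diff_distrib mult.assoc cvec_square aa)
  thus ?thesis
    by (simp add: reflection_def aa linear_diff [OF linear_cvec] linear_cmul [OF linear_cvec])
qed

text \<open>The crystallographic condition is not imposed, since type \<open>H\<^sub>4\<close> violates it.\<close>

definition root_system :: "'a::euclidean_space set \<Rightarrow> bool" where
  "root_system \<Phi> \<longleftrightarrow> finite \<Phi> \<and> 0 \<notin> \<Phi> \<and> span \<Phi> = UNIV \<and>
     (\<forall>a\<in>\<Phi>. \<Phi> \<inter> range (\<lambda>c. c *\<^sub>R a) = {a, - a}) \<and>
     (\<forall>a\<in>\<Phi>. reflection a ` \<Phi> = \<Phi>)"

definition simple_system :: "'a::euclidean_space set \<Rightarrow> 'a set \<Rightarrow> bool" where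
  "simple_system \<Phi> \<Delta> \<longleftrightarrow> \<Delta> \<subseteq> \<Phi> \<and> independent \<Delta> \<and>
     (\<forall>b\<in>\<Phi>. \<exists>c. b = (\<Sum>a\<in>\<Delta>. c a *\<^sub>R a) \<and> ((\<forall>a\<in>\<Delta>. 0 \<le> c a) \<or> (\<forall>a\<in>\<Delta>. c a \<le> 0)))"

datatype diagram = A4 | B4 | D4 | F4 | H4

text \<open>
  The label of the pair of nodes \<open>i < j\<close> of the Coxeter diagram with nodes \<open>1, \<dots>, 4\<close>;
  as usual, the label is \<open>2\<close> for nodes that are not linked.
\<close>

fun label :: "diagram \<Rightarrow> nat \<times> nat \<Rightarrow> nat" where
  "label A4 p = (if p \<in> {(1,2), (2,3), (3,4)} then 3 else 2)"
| "label B4 p = (if p \<in> {(1,2), (2,3)} then 3 else if p = (3,4) then 4 else 2)"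
| "label D4 p = (if p \<in> {(1,2), (2,3), (2,4)} then 3 else 2)"
| "label F4 p = (if p \<in> {(1,2), (3,4)} then 3 else if p = (2,3) then 4 else 2)"
| "label H4 p = (if p \<in> {(1,2), (2,3)} then 3 else if p = (3,4) then 5 else 2)"

text \<open>The simple roots of two nodes with label \<open>m\<close> enclose the angle \<open>\<pi> - \<pi>/m\<close>.\<close>

definition has_diagram :: "'a::euclidean_space set \<Rightarrow> diagram \<Rightarrow> bool" where
  "has_diagram \<Delta> X \<longleftrightarrow> (\<exists>g. bij_betw g {1..4} \<Delta> \<and>
     (\<forall>i j. 1 \<le> i \<and> i < j \<and> j \<le> 4 \<longrightarrow> sgn (g i) \<bullet> sgn (g j) = - cos (pi / label X (i, j))))"

section \<open>Coxeter elements and versors\<close>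

text \<open>
  The versor is the product of the simple roots after normalisation to unit length. In
  \<open>coxeter_element\<close> the reflection in the first root of the list is applied first, which
  corresponds to the product of vectors from left to right, see \<open>cvec_coxeter_element\<close>.
\<close>

definition versor :: "(real ^ 'n::{finite,linorder}) list \<Rightarrow> 'n clifford" where
  "versor as = prod_list (map (\<lambda>a. cvec (sgn a)) as)"

definition coxeter_element :: "'a::euclidean_space list \<Rightarrow> 'a \<Rightarrow> 'a" where
  "coxeter_element as = fold reflection as"

lemma cvec_coxeter_element:
  assumes "0 \<notin> set as"
  shows "cvec (coxeter_element as v)
    = (- 1) ^ length as * (versor (rev as) * cvec v * versor as)"
  using assms
proof (induction as arbitrary: v)
  case Nil
  show ?case by (simp add: coxeter_element_def versor_def)
next
  case (Cons a as)
  have "cvec (reflection a v) = - (cvec (sgn a) * cvec v * cvec (sgn a))"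
    using Cons.prems cvec_reflection [of "sgn a" v] by (simp add: norm_sgn reflection_sgn)
  with Cons show ?case
    by (simp add: coxeter_element_def versor_def mult.assoc)
qed

definition coxeter_number :: "('a \<Rightarrow> 'a) \<Rightarrow> nat" where
  "coxeter_number w = (LEAST n. 0 < n \<and> w ^^ n = id)"

definition complex_charpoly :: "(real ^ 'n \<Rightarrow> real ^ 'n) \<Rightarrow> complex poly" where
  "complex_charpoly w = det (mat [:0, 1:] - map_matrix (\<lambda>x. [:complex_of_real x:]) (matrix w))"

definition exponents :: "(real ^ 'n \<Rightarrow> real ^ 'n) \<Rightarrow> nat multiset" where
  "exponents w = (let h = coxeter_number w in
     \<Sum>m\<in>{0<..<h}. replicate_mset (order (exp (2 * pi * \<i> * m / h)) (complex_charpoly w)) m)"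

definition orthonormal_basis2 :: "'a::euclidean_space \<Rightarrow> 'a \<Rightarrow> 'a set \<Rightarrow> bool" where
  "orthonormal_basis2 u v P \<longleftrightarrow> norm u = 1 \<and> norm v = 1 \<and> u \<bullet> v = 0 \<and> span {u, v} = P"

definition rotates_plane :: "('a::euclidean_space \<Rightarrow> 'a) \<Rightarrow> real \<Rightarrow> 'a set \<Rightarrow> bool" where
  "rotates_plane w \<theta> P \<longleftrightarrow> (\<exists>u v. orthonormal_basis2 u v P \<and>
     w u = cos \<theta> *\<^sub>R u + sin \<theta> *\<^sub>R v \<and> w v = cos \<theta> *\<^sub>R v - sin \<theta> *\<^sub>R u)"

definition coxeter_plane :: "('a::euclidean_space \<Rightarrow> 'a) \<Rightarrow> 'a set \<Rightarrow> bool" where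
  "coxeter_plane w P \<longleftrightarrow> rotates_plane w (2 * pi / coxeter_number w) P"

definition unit_bivector :: "(real ^ 'n::{finite,linorder}) set \<Rightarrow> 'n clifford \<Rightarrow> bool" where
  "unit_bivector P B \<longleftrightarrow> (\<exists>u v. orthonormal_basis2 u v P \<and> B = cvec u * cvec v)"

lemma unit_bivector_square:
  assumes "unit_bivector P B"
  shows "B * B = - 1"
proof -
  from assms obtain u v where uv: "norm u = 1" "norm v = 1" "u \<bullet> v = 0" and B: "B = cvec u * cvec v"
    by (auto simp: unit_bivector_def orthonormal_basis2_def)
  have sq: "cvec u * cvec u = 1" "cvec v * cvec v = 1"
    using uv by (simp_all add: cvec_square dot_square_norm)
  have "cvec v * cvec u = - (cvec u * cvec v)"
    using cvec_anticommutator [of u v] uv by (simp add: add_eq_0_iff2)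
  hence "cvec u * cvec v * (cvec u * cvec v) = - (cvec u * cvec u) * (cvec v * cvec v)"
    by (metis (no_types, opaque_lifting) minus_mult_left minus_mult_right mult.assoc)
  thus ?thesis by (simp add: B sq)
qed

definition coxeter_bivector ::
  "(real ^ 'n::{finite,linorder} \<Rightarrow> real ^ 'n::{finite,linorder}) \<Rightarrow> 'n clifford \<Rightarrow> bool" where
  "coxeter_bivector w B \<longleftrightarrow> (\<exists>P. coxeter_plane w P \<and> unit_bivector P B)"

definition factorises :: "4 clifford \<Rightarrow> 4 clifford \<Rightarrow> real \<Rightarrow> real \<Rightarrow> bool" where
  "factorises W B s t \<longleftrightarrow> (\<exists>\<epsilon>\<in>{1, - 1}. \<exists>\<epsilon>\<^sub>1\<in>{1, - 1}. \<exists>\<epsilon>\<^sub>2\<in>{1, - 1}.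
     W = \<epsilon> *\<^sub>R (exp ((\<epsilon>\<^sub>1 * s) *\<^sub>R B) * exp ((\<epsilon>\<^sub>2 * t) *\<^sub>R (pseudoscalar * B))))"

end

theory Submission
  imports Defs
begin

text \<open>
  A Coxeter element \<open>w\<close> of one of the five types is an isometry of four-space that fixes no nonzero
  vector, so it is a double rotation: it turns some plane by an angle \<open>\<theta>\<close> and the orthogonal plane by
  an angle \<open>\<phi>\<close> (\<open>double_rotation_exists\<close>). A rotation by \<open>\<theta>\<close> is the product of two reflections in
  vectors that enclose the angle \<open>\<theta>/2\<close>. Hence \<open>w\<close> is also the product of four reflections whose
  vectors have the Clifford product \<open>exp((\<theta>/2) uv) exp((\<phi>/2) pq)\<close>, where \<open>u, v\<close> and \<open>p, q\<close> are
  orthonormal bases of the two planes. A versor is determined up to sign by the isometry that it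
  induces (\<open>versor_unique\<close>), because a quotient of two such versors commutes with all vectors. So the
  Coxeter versor equals this product of exponentials up to sign. The same uniqueness, applied to
  \<open>w = - id\<close>, shows that \<open>pq\<close> is the pseudoscalar times \<open>uv\<close> up to sign.

  It remains to find the two angles, for every order of the simple roots. Two quantities are read
  off from the Gram matrix of the roots (\<open>double_rotation_invariants\<close>): the trace of \<open>w\<close>, which is
  \<open>2 cos \<theta> + 2 cos \<phi>\<close>, and the scalar part of the versor, which is \<open>\<plusminus> cos(\<theta>/2) cos(\<phi>/2)\<close>.
  The trace is a constant plus a sum over edges, triangles and a four-cycle of the diagram, and the scalar part is a
  signed sum over its perfect matchings. Since the diagram is a tree, it has no cycles and at most one
  perfect matching, so neither the trace nor the square of the scalar part depends on the order
  (\<open>tree_diagram_invariants\<close>). These two numbers determine the cosines of the angles as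
  the roots of a quadratic equation, and comparison with the known cosines gives \<open>\<theta> = 2\<pi>/h\<close> and
  \<open>\<phi> = 2\<pi>m/h\<close>, with \<open>m\<close> the second exponent (\<open>coxeter_element_double_rotation\<close>).
  The order of \<open>w\<close>, its eigenvalues and the uniqueness of the Coxeter plane are then properties of
  a double rotation with these angles.
\<close>

section \<open>Versors and the isometries they induce\<close>

text \<open>
  Left multiplication by a vector is self-adjoint for this inner product (\<open>blade_inner_cvec_mult\<close>),
  so unit vectors act by isometries. The scalar part of \<open>x\<close> is \<open>blade_inner 1 x\<close>.
\<close>

definition blade_inner :: "'n::{finite,linorder} clifford \<Rightarrow> 'n clifford \<Rightarrow> real" where
  "blade_inner x y = (\<Sum>S\<in>UNIV. blade_coeff x S * blade_coeff y S)"

lemma blade_inner_add_left: "blade_inner (x + y) z = blade_inner x z + blade_inner y z"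
  and blade_inner_add_right: "blade_inner z (x + y) = blade_inner z x + blade_inner z y"
  and blade_inner_diff_right: "blade_inner z (x - y) = blade_inner z x - blade_inner z y"
  and blade_inner_scaleR_left: "blade_inner (r *\<^sub>R x) z = r * blade_inner x z"
  and blade_inner_scaleR_right: "blade_inner z (r *\<^sub>R x) = r * blade_inner z x"
  by (simp_all add: blade_inner_def algebra_simps sum.distrib sum_subtractf sum_distrib_left)

lemma blade_inner_zero [simp]: "blade_inner 0 z = 0" "blade_inner z 0 = 0"
  by (simp_all add: blade_inner_def)

lemma blade_inner_sum_left: "blade_inner (sum f A) z = (\<Sum>a\<in>A. blade_inner (f a) z)"
  and blade_inner_sum_right: "blade_inner z (sum f A) = (\<Sum>a\<in>A. blade_inner z (f a))"
  by (induction A rule: infinite_finite_induct) (simp_all add: blade_inner_add_left blade_inner_add_right)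

lemma blade_inner_one_one [simp]: "blade_inner 1 1 = 1"
  by (simp add: blade_inner_def one_clifford_def if_distrib [of "\<lambda>t. _ * t"] cong: if_cong)

lemma blade_coeff_gen_mult:
  "blade_coeff (gen i * x) U = blade_sign {i} (sym_diff {i} U) * blade_coeff x (sym_diff {i} U)"
proof -
  have "blade_coeff (gen i * x) U = (\<Sum>S\<in>UNIV. if S = {i}
      then blade_sign {i} (sym_diff {i} U) * blade_coeff x (sym_diff {i} U) else 0)"
    unfolding times_clifford_def gen_def blade_coeff_Clifford by (rule sum.cong) auto
  thus ?thesis by simp
qed

lemma blade_coeff_mult_gen:
  "blade_coeff (x * gen i) U = blade_sign (sym_diff {i} U) {i} * blade_coeff x (sym_diff {i} U)"
proof -
  have eq: "sym_diff S U = {i} \<longleftrightarrow> S = sym_diff {i} U" for S by auto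
  have [simp]: "sym_diff (sym_diff {i} U) U = {i}" by auto
  have "blade_coeff (x * gen i) U = (\<Sum>S\<in>UNIV. if S = sym_diff {i} U
      then blade_sign (sym_diff {i} U) {i} * blade_coeff x (sym_diff {i} U) else 0)"
    unfolding times_clifford_def gen_def blade_coeff_Clifford eq by (rule sum.cong) auto
  thus ?thesis by simp
qed

text \<open>
  Multiplication by a generator permutes the blades up to sign, is an involution, and uses the same
  sign in both directions, because a generator has sign \<open>1\<close> with itself.
\<close>

lemma blade_inner_gen_mult: "blade_inner (gen i * x) y = blade_inner x (gen i * y)"
proof -
  have sgn: "blade_sign {i} (sym_diff {i} T) = blade_sign {i} T" for T
    by (simp add: blade_sign_right) (simp add: blade_sign_def)
  have "blade_inner (gen i * x) y
      = (\<Sum>U\<in>UNIV. blade_sign {i} U * blade_coeff x (sym_diff {i} U) * blade_coeff y U)"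
    unfolding blade_inner_def blade_coeff_gen_mult sgn ..
  also have "\<dots> = (\<Sum>U\<in>UNIV. blade_sign {i} (sym_diff {i} U)
      * blade_coeff x (sym_diff {i} (sym_diff {i} U)) * blade_coeff y (sym_diff {i} U))"
    by (rule sum_sym_diff [symmetric, of _ "{i}"])
  also have "\<dots> = blade_inner x (gen i * y)"
    unfolding blade_inner_def blade_coeff_gen_mult sym_diff_cancel sgn
    by (simp add: mult_ac)
  finally show ?thesis .
qed

lemma blade_inner_cvec_mult: "blade_inner (cvec a * x) y = blade_inner x (cvec a * y)"
  by (simp add: cvec_def sum_distrib_right blade_inner_sum_left blade_inner_sum_right
      blade_inner_scaleR_left blade_inner_scaleR_right blade_inner_gen_mult)

lemma blade_inner_one_mult_commute:
  fixes x y :: "'n::{finite,linorder} clifford"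
  shows "blade_inner 1 (x * y) = blade_inner 1 (y * x)"
proof -
  have "blade_inner 1 (x * y) = (\<Sum>S\<in>UNIV. blade_sign S S * blade_coeff x S * blade_coeff y S)" for x y :: "'n clifford"
  proof -
    have "blade_inner 1 (x * y) = (\<Sum>U\<in>(UNIV :: 'n set set). if U = {} then blade_coeff (x * y) {} else 0)"
      unfolding blade_inner_def one_clifford_def blade_coeff_Clifford by (rule sum.cong) auto
    thus ?thesis by (simp add: times_clifford_def)
  qed
  thus ?thesis by (simp add: mult_ac)
qed

lemma blade_inner_one_vectors2: "blade_inner 1 (cvec a * cvec b) = a \<bullet> b"
proof -
  have "blade_inner 1 (cvec a * cvec b + cvec b * cvec a) = 2 * (a \<bullet> b)"
    unfolding cvec_anticommutator by (simp add: blade_inner_scaleR_right)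
  thus ?thesis
    using blade_inner_one_mult_commute [of "cvec a" "cvec b"] by (simp add: blade_inner_add_right)
qed

text \<open>
  Moving \<open>a\<close> through \<open>b\<close>, \<open>c\<close> and \<open>d\<close> costs one anticommutator each and ends in \<open>- bcda\<close>, which has
  the scalar part of \<open>- abcd\<close> as the scalar part is cyclic. The terms correspond to the three perfect
  matchings of four points: the value is the Pfaffian of the Gram matrix above its diagonal.
\<close>

lemma blade_inner_one_vectors4:
  "blade_inner 1 (cvec a * cvec b * cvec c * cvec d)
    = (a \<bullet> b) * (c \<bullet> d) - (a \<bullet> c) * (b \<bullet> d) + (a \<bullet> d) * (b \<bullet> c)"
proof -
  have swap: "cvec a * cvec x = (2 * (a \<bullet> x)) *\<^sub>R 1 - cvec x * cvec a" for x
    using cvec_anticommutator [of a x] by (simp add: algebra_simps)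
  let ?a = "cvec a" and ?b = "cvec b" and ?c = "cvec c" and ?d = "cvec d"
  have "?a * ?b * ?c * ?d = (2 * (a \<bullet> b)) *\<^sub>R (?c * ?d) - ?b * (?a * ?c) * ?d"
    unfolding swap [of b] by (simp add: algebra_simps)
  also have "?b * (?a * ?c) * ?d = (2 * (a \<bullet> c)) *\<^sub>R (?b * ?d) - ?b * ?c * (?a * ?d)"
    unfolding swap [of c] by (simp add: algebra_simps)
  also have "?b * ?c * (?a * ?d) = (2 * (a \<bullet> d)) *\<^sub>R (?b * ?c) - ?b * ?c * ?d * ?a"
    unfolding swap [of d] by (simp add: algebra_simps)
  finally have "?a * ?b * ?c * ?d + ?b * ?c * ?d * ?a = (2 * (a \<bullet> b)) *\<^sub>R (?c * ?d)
      + (- 2 * (a \<bullet> c)) *\<^sub>R (?b * ?d) + (2 * (a \<bullet> d)) *\<^sub>R (?b * ?c)"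
    by (simp add: algebra_simps)
  from arg_cong [OF this, of "blade_inner 1"]
  show ?thesis
    using blade_inner_one_mult_commute [of ?a "?b * ?c * ?d"]
    by (simp add: blade_inner_add_right blade_inner_diff_right blade_inner_scaleR_right
        blade_inner_one_vectors2 mult.assoc)
qed

lemma versor_Nil [simp]: "versor [] = 1"
  and versor_Cons: "versor (a # as) = cvec (sgn a) * versor as"
  and versor_append: "versor (as @ bs) = versor as * versor bs"
  by (simp_all add: versor_def)

lemma cvec_sgn_square: "a \<noteq> 0 \<Longrightarrow> cvec (sgn a) * cvec (sgn a) = 1"
  by (simp add: cvec_square dot_square_norm norm_sgn)

lemma versor_rev_inverse:
  fixes as :: "(real ^ 'n::{finite,linorder}) list"
  assumes "0 \<notin> set as"
  shows "versor as * versor (rev as) = 1" "versor (rev as) * versor as = 1"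
proof -
  have inv: "versor as * versor (rev as) = 1" if "0 \<notin> set as" for as :: "(real ^ 'n::{finite,linorder}) list"
    using that
  proof (induction as)
    case (Cons a as)
    have "versor (a # as) * versor (rev (a # as))
        = cvec (sgn a) * (versor as * versor (rev as)) * cvec (sgn a)"
      by (simp add: versor_append versor_Cons mult.assoc)
    with Cons show ?case by (simp add: cvec_sgn_square)
  qed simp
  show "versor as * versor (rev as) = 1"
    using inv [of as] assms .
  show "versor (rev as) * versor as = 1"
    using inv [of "rev as"] assms by simp
qed

lemma blade_inner_versor_mult:
  assumes "0 \<notin> set as"
  shows "blade_inner (versor as * x) (versor as * x) = blade_inner x x"
  using assms
proof (induction as)
  case (Cons a as)
  have "cvec (sgn a) * (cvec (sgn a) * y) = y" for y
    using Cons.prems cvec_sgn_square [of a] by (simp flip: mult.assoc)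
  with Cons show ?case
    by (simp add: versor_Cons mult.assoc blade_inner_cvec_mult)
qed simp

lemma blade_sign_singleton_commute:
  "blade_sign {i} S = (- 1) ^ card (S - {i}) * blade_sign S {i}"
proof -
  have "blade_sign {i} S * blade_sign S {i}
      = (\<Prod>j\<in>S. (if j < i then - 1 else 1) * (if i < j then - 1 else 1))"
    by (simp add: blade_sign_def prod.distrib)
  also have "\<dots> = (\<Prod>j\<in>S - {i}. - 1)"
    by (rule prod.mono_neutral_cong_right) auto
  finally have "blade_sign {i} S * blade_sign S {i} = (- 1) ^ card (S - {i})"
    by simp
  moreover have "blade_sign S {i} * blade_sign S {i} = 1"
    by (metis abs_blade_sign abs_mult_self_eq mult_1)
  ultimately show ?thesis
    by (metis mult.assoc mult.right_neutral)
qed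

text \<open>
  The generator with index \<open>i\<close> anticommutes with the blade of \<open>S\<close> when \<open>S - {i}\<close> has an odd number of
  elements. Such an index exists for every nonempty \<open>S\<close>: inside \<open>S\<close> if \<open>S\<close> is even, outside \<open>S\<close> if
  \<open>S\<close> is odd. The latter is where an even dimension enters, as the blade of all indices is central in
  odd dimensions.
\<close>

lemma central_imp_scalar:
  fixes x :: "'n::{finite,linorder} clifford"
  assumes "even (CARD('n))" and comm: "\<And>v. x * cvec v = cvec v * x"
  shows "\<exists>c. x = c *\<^sub>R 1"
proof -
  have zero: "blade_coeff x S = 0" if "S \<noteq> {}" for S
  proof -
    have "\<exists>i. odd (card (S - {i}))"
    proof (cases "even (card S)")
      case True
      obtain i where "i \<in> S" using \<open>S \<noteq> {}\<close> by blast
      hence "Suc (card (S - {i})) = card S"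
        by (intro card.remove [symmetric]) auto
      with True have "odd (card (S - {i}))" by (metis even_Suc)
      thus ?thesis ..
    next
      case False
      with assms(1) have "S \<noteq> UNIV" by auto
      then obtain i where "i \<notin> S" by blast
      with False show ?thesis by (intro exI [of _ i]) simp
    qed
    then obtain i where "odd (card (S - {i}))" ..
    hence neg: "blade_sign {i} S = - blade_sign S {i}"
      by (simp add: blade_sign_singleton_commute)
    have "blade_coeff (gen i * x) (sym_diff {i} S) = blade_coeff (x * gen i) (sym_diff {i} S)"
      using comm [of "axis i 1"] by (simp add: cvec_axis)
    hence "blade_sign {i} S * blade_coeff x S = blade_sign S {i} * blade_coeff x S"
      unfolding blade_coeff_gen_mult blade_coeff_mult_gen sym_diff_cancel .
    moreover have "blade_sign S {i} \<noteq> 0"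
      by (metis abs_blade_sign abs_zero zero_neq_one)
    ultimately show ?thesis by (simp add: neg)
  qed
  have "x = blade_coeff x {} *\<^sub>R 1"
    by (rule clifford_eqI) (auto simp: one_clifford_def zero)
  thus ?thesis ..
qed

text \<open>
  If \<open>V\<close> and \<open>W\<close> induce the same isometry, then \<open>W\<close> times the inverse of \<open>V\<close> commutes with every
  vector, hence is a scalar; and that scalar is \<open>\<plusminus> 1\<close> since versors have norm \<open>1\<close>.
\<close>

lemma versor_unique:
  fixes as bs :: "(real ^ 'n::{finite,linorder}) list"
  assumes "even (CARD('n))" and as: "0 \<notin> set as" and bs: "0 \<notin> set bs"
    and par: "even (length as) = even (length bs)"
    and eq: "coxeter_element as = coxeter_element bs"
  shows "versor bs = versor as \<or> versor bs = - versor as"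
proof -
  let ?C = "versor bs * versor (rev as)"
  have sandwich: "versor (rev as) * cvec v * versor as = versor (rev bs) * cvec v * versor bs" for v
  proof -
    have "(- 1) ^ length as = ((- 1) ^ length bs :: 'n clifford)"
      using par by (cases "even (length as)") auto
    moreover have "((- 1) ^ length bs :: 'n clifford) * (- 1) ^ length bs = 1"
      by (simp flip: power_add)
    moreover have "(- 1) ^ length as * (versor (rev as) * cvec v * versor as)
        = (- 1) ^ length bs * (versor (rev bs) * cvec v * versor bs)"
      using cvec_coxeter_element [OF as, of v] cvec_coxeter_element [OF bs, of v] eq by simp
    ultimately have "(- 1) ^ length bs * ((- 1) ^ length bs * (versor (rev as) * cvec v * versor as))
        = (- 1) ^ length bs * ((- 1) ^ length bs * (versor (rev bs) * cvec v * versor bs))"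
      by simp
    thus ?thesis
      unfolding mult.assoc [symmetric, of "(- 1) ^ length bs"]
      by (simp add: \<open>(- 1) ^ length bs * (- 1) ^ length bs = 1\<close> mult.assoc)
  qed
  have "?C * cvec v = cvec v * ?C" for v
  proof -
    have "?C * cvec v = versor bs * (versor (rev as) * cvec v * versor as) * versor (rev as)"
      using versor_rev_inverse [OF as] by (simp add: mult.assoc)
    also have "\<dots> = (versor bs * versor (rev bs)) * cvec v * ?C"
      unfolding sandwich by (simp add: mult.assoc)
    finally show ?thesis using versor_rev_inverse [OF bs] by simp
  qed
  then obtain c where c: "?C = c *\<^sub>R 1"
    using central_imp_scalar [OF assms(1)] by blast
  have "?C * versor as = versor bs"
    using versor_rev_inverse [OF as] by (simp add: mult.assoc)
  hence bs_eq: "versor bs = c *\<^sub>R versor as"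
    by (simp add: c)
  have norm1: "blade_inner (versor cs) (versor cs) = 1" if "0 \<notin> set cs" for cs :: "(real ^ 'n::{finite,linorder}) list"
    using blade_inner_versor_mult [OF that, of 1] by simp
  have "c * c = 1"
    using norm1 [OF bs] norm1 [OF as]
    by (simp add: bs_eq blade_inner_scaleR_left blade_inner_scaleR_right)
  hence "c = 1 \<or> c = - 1"
    by (simp add: square_eq_1_iff)
  thus ?thesis by (auto simp: bs_eq)
qed

section \<open>Isometries of four-space as double rotations\<close>

definition orthonormal4 :: "real ^ 4 \<Rightarrow> real ^ 4 \<Rightarrow> real ^ 4 \<Rightarrow> real ^ 4 \<Rightarrow> bool" where
  "orthonormal4 u v p q \<longleftrightarrow> u \<bullet> u = 1 \<and> v \<bullet> v = 1 \<and> p \<bullet> p = 1 \<and> q \<bullet> q = 1 \<and>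
     u \<bullet> v = 0 \<and> u \<bullet> p = 0 \<and> u \<bullet> q = 0 \<and> v \<bullet> p = 0 \<and> v \<bullet> q = 0 \<and> p \<bullet> q = 0"

lemma orthonormal4_expand:
  assumes "orthonormal4 u v p q"
  shows "x = (x \<bullet> u) *\<^sub>R u + (x \<bullet> v) *\<^sub>R v + (x \<bullet> p) *\<^sub>R p + (x \<bullet> q) *\<^sub>R q"
proof -
  note fr = assms [unfolded orthonormal4_def]
  have com: "v \<bullet> u = 0" "p \<bullet> u = 0" "q \<bullet> u = 0" "p \<bullet> v = 0" "q \<bullet> v = 0" "q \<bullet> p = 0"
    using fr by (simp_all add: inner_commute)
  let ?S = "{u, v, p, q}"
  have dist: "u \<noteq> v" "u \<noteq> p" "u \<noteq> q" "v \<noteq> p" "v \<noteq> q" "p \<noteq> q"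
    using fr by auto
  have "0 \<notin> ?S" using fr by auto
  moreover have "pairwise orthogonal ?S"
    using fr com by (auto simp: pairwise_def orthogonal_def)
  ultimately have "independent ?S"
    by (intro pairwise_orthogonal_independent)
  moreover have "card ?S = dim (UNIV :: (real ^ 4) set)"
    using dist by simp
  ultimately have "span ?S = UNIV"
    by (metis card_eq_dim finite.emptyI finite.insertI subset_UNIV top.extremum_uniqueI)
  define z where "z = x - ((x \<bullet> u) *\<^sub>R u + (x \<bullet> v) *\<^sub>R v + (x \<bullet> p) *\<^sub>R p + (x \<bullet> q) *\<^sub>R q)"
  have "orthogonal z y" if "y \<in> ?S" for y
    using that fr com by (auto simp: z_def orthogonal_def inner_diff_left inner_add_left)
  hence "orthogonal z z"
    using orthogonal_to_span [of z ?S z] \<open>span ?S = UNIV\<close> by auto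
  hence "z = 0" by (simp add: orthogonal_self)
  thus ?thesis by (simp add: z_def)
qed

lemma orthonormal4_inner:
  assumes "orthonormal4 u v p q"
  shows "x \<bullet> y = (u \<bullet> x) * (u \<bullet> y) + (v \<bullet> x) * (v \<bullet> y) + (p \<bullet> x) * (p \<bullet> y) + (q \<bullet> x) * (q \<bullet> y)"
  by (subst orthonormal4_expand [OF assms, of x])
    (simp add: inner_add_left inner_commute [of x])

lemma exists_orthogonal_unit:
  fixes S :: "(real ^ 4) set"
  assumes "finite S" "card S \<le> 3"
  shows "\<exists>x. x \<bullet> x = 1 \<and> (\<forall>y\<in>S. x \<bullet> y = 0)"
proof -
  have "dim S < DIM(real ^ 4)"
    using dim_le_card' [of S] assms by simp
  then obtain x where x: "x \<noteq> 0" "\<And>y. y \<in> span S \<Longrightarrow> orthogonal x y"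
    by (rule orthogonal_to_subspace_exists) blast
  show ?thesis
  proof (intro exI conjI ballI)
    show "sgn x \<bullet> sgn x = 1" using x by (simp add: dot_square_norm norm_sgn)
    fix y assume "y \<in> S"
    hence "orthogonal x y" by (simp add: x span_base)
    thus "sgn x \<bullet> y = 0" by (simp add: sgn_div_norm orthogonal_def)
  qed
qed

lemma orthonormal4_extend:
  assumes "norm u = 1" "norm v = 1" "u \<bullet> v = 0"
  obtains p q where "orthonormal4 u v p q"
proof -
  have c2: "card {u, v} \<le> 3" by (simp add: card_insert_if)
  obtain p where p: "p \<bullet> p = 1" "p \<bullet> u = 0" "p \<bullet> v = 0"
    using exists_orthogonal_unit [OF _ c2] by auto
  have c3: "card {u, v, p} \<le> 3" by (simp add: card_insert_if)
  obtain q where "q \<bullet> q = 1" "q \<bullet> u = 0" "q \<bullet> v = 0" "q \<bullet> p = 0"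
    using exists_orthogonal_unit [OF _ c3] by auto
  with p assms have "orthonormal4 u v p q"
    by (simp add: orthonormal4_def inner_commute dot_square_norm)
  thus ?thesis by (rule that)
qed

text \<open>
  A maximum \<open>u\<close> of \<open>x \<bullet> w x\<close> on the unit sphere of \<open>V\<close> is an eigenvector of \<open>w\<close> plus its inverse, so
  that \<open>u\<close> and \<open>w u\<close> span an invariant plane, unless \<open>w u = - u\<close>; but then maximality makes \<open>w\<close> equal
  to \<open>- id\<close> on all of \<open>V\<close>, and any plane through \<open>u\<close> will do. The last conclusion records that \<open>\<theta>\<close> is
  the smallest angle by which \<open>w\<close> moves a vector of \<open>V\<close>, which later orders the two rotation angles.
\<close>

lemma invariant_plane:
  fixes w :: "'a::euclidean_space \<Rightarrow> 'a"
  assumes lin: "linear w" and iso: "\<And>x y. w x \<bullet> w y = x \<bullet> y"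
    and fix0: "\<And>x. w x = x \<Longrightarrow> x = 0"
    and V: "subspace V" "\<And>x. x \<in> V \<Longrightarrow> w x \<in> V"
    and big: "\<exists>u\<in>V. u \<bullet> u = 1" "\<And>u. u \<in> V \<Longrightarrow> \<exists>v\<in>V. v \<bullet> v = 1 \<and> u \<bullet> v = 0"
  obtains u v \<theta> where "u \<in> V" "v \<in> V" "u \<bullet> u = 1" "v \<bullet> v = 1" "u \<bullet> v = 0"
    "0 < \<theta>" "\<theta> \<le> pi" "w u = cos \<theta> *\<^sub>R u + sin \<theta> *\<^sub>R v" "w v = cos \<theta> *\<^sub>R v - sin \<theta> *\<^sub>R u"
    "\<And>x. x \<in> V \<Longrightarrow> x \<bullet> w x \<le> cos \<theta> * (x \<bullet> x)"
proof -
  let ?K = "V \<inter> sphere 0 1"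
  have "compact ?K"
    using closed_subspace [OF V(1)] by (intro closed_Int_compact) auto
  moreover have "?K \<noteq> {}"
    using big(1) by (auto simp: norm_eq_1)
  moreover have "continuous_on ?K (\<lambda>x. x \<bullet> w x)"
    by (intro continuous_intros linear_continuous_on linear_conv_bounded_linear [THEN iffD1] lin)
  ultimately obtain u where u: "u \<in> ?K" and max: "\<And>x. x \<in> ?K \<Longrightarrow> x \<bullet> w x \<le> u \<bullet> w u"
    using continuous_attains_sup [of ?K "\<lambda>x. x \<bullet> w x"] by blast
  define c where "c = u \<bullet> w u"
  have uu: "u \<bullet> u = 1" and uV: "u \<in> V" using u by (auto simp: norm_eq_1)
  have le: "x \<bullet> w x \<le> c * (x \<bullet> x)" if "x \<in> V" for x
  proof (cases "x = 0")
    case True thus ?thesis by simp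
  next
    case False
    have "sgn x \<in> ?K" using that False V(1) by (simp add: norm_sgn) (simp add: sgn_div_norm subspace_scale)
    hence "sgn x \<bullet> w (sgn x) \<le> c" unfolding c_def by (rule max)
    hence "(x \<bullet> w x) / (norm x)\<^sup>2 \<le> c"
      by (simp add: sgn_div_norm linear_cmul [OF lin] power2_eq_square divide_simps)
    thus ?thesis using False by (simp add: divide_simps dot_square_norm mult.commute)
  qed
  \<comment> \<open>Vanishing of the first variation of \<open>c |x|\<^sup>2 - x \<bullet> w x\<close>, which is minimal at \<open>u\<close>.\<close>
  have stat: "x \<bullet> w u + u \<bullet> w x = 2 * c * (u \<bullet> x)" if "x \<in> V" for x
  proof -
    define b where "b = x \<bullet> w u + u \<bullet> w x - 2 * c * (u \<bullet> x)"
    define a where "a = c * (x \<bullet> x) - x \<bullet> w x"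
    have "t * b \<le> t\<^sup>2 * a" for t
    proof -
      have "u + t *\<^sub>R x \<in> V" using uV that V(1) by (simp add: subspace_add subspace_scale)
      from le [OF this] show ?thesis
        by (simp add: a_def b_def linear_add [OF lin] linear_cmul [OF lin] inner_add_left
            inner_add_right uu c_def [symmetric] inner_commute [of x u] power2_eq_square algebra_simps)
    qed
    moreover have "b = 0" if h: "\<And>t::real. t * b \<le> t\<^sup>2 * a"
    proof -
      have "\<bar>b\<bar> \<le> \<bar>a\<bar> * e" if "e > 0" for e
      proof -
        have "e * b \<le> e * (e * a)" "e * (- b) \<le> e * (e * a)"
          using h [of e] h [of "- e"] by (simp_all add: power2_eq_square mult.assoc)
        hence "b \<le> e * a" "- b \<le> e * a"
          using \<open>e > 0\<close> by (simp_all only: mult_le_cancel_left_pos)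
        moreover have "e * a \<le> e * \<bar>a\<bar>" using \<open>e > 0\<close> by simp
        ultimately show ?thesis by (simp add: mult.commute)
      qed
      hence "\<bar>b\<bar> \<le> 0 + e" if "e > 0" for e
      proof -
        have "\<bar>b\<bar> \<le> \<bar>a\<bar> * (e / (\<bar>a\<bar> + 1))"
          using \<open>e > 0\<close> by (intro \<open>\<And>e. e > 0 \<Longrightarrow> \<bar>b\<bar> \<le> \<bar>a\<bar> * e\<close>) simp
        also have "\<dots> \<le> e" using \<open>e > 0\<close> by (simp add: divide_simps algebra_simps)
        finally show ?thesis by simp
      qed
      hence "\<bar>b\<bar> \<le> 0" by (rule field_le_epsilon)
      thus ?thesis by simp
    qed
    ultimately have "b = 0" by blast
    thus ?thesis by (simp add: b_def)
  qed
  have wuu: "w u \<bullet> w u = 1" by (simp add: iso uu)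
  have c_abs: "\<bar>c\<bar> \<le> 1"
    using Cauchy_Schwarz_ineq2 [of u "w u"] uu wuu by (simp add: c_def norm_eq_sqrt_inner)
  have c_ne: "c \<noteq> 1"
  proof
    assume "c = 1"
    have "(w u - u) \<bullet> (w u - u) = 0"
      using wuu uu \<open>c = 1\<close> by (simp add: c_def inner_diff_left inner_diff_right inner_commute)
    hence "w u = u" by simp
    hence "u = 0" by (rule fix0)
    with uu show False by simp
  qed
  define \<theta> where "\<theta> = arccos c"
  have cos: "cos \<theta> = c" using c_abs by (simp add: \<theta>_def cos_arccos_abs)
  have th: "0 < \<theta>" "\<theta> \<le> pi"
  proof -
    have "\<theta> \<noteq> 0" using cos c_ne by auto
    thus "0 < \<theta>" "\<theta> \<le> pi"
      using c_abs arccos_lbound [of c] arccos_ubound [of c] by (auto simp: \<theta>_def abs_le_iff less_le)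
  qed
  \<comment> \<open>The difference \<open>z\<close> of the two sides has norm zero, by the first variation in direction \<open>w u\<close>.\<close>
  have wwu: "w (w u) = (2 * c) *\<^sub>R w u - u"
  proof -
    have 1: "u \<bullet> w (w u) = 2 * c * c - 1"
      using stat [OF V(2) [OF uV]] by (simp add: wuu c_def)
    have 2: "w u \<bullet> w (w u) = c" by (simp add: iso c_def)
    have 3: "w (w u) \<bullet> w (w u) = 1" by (simp add: iso uu)
    define z where "z = w (w u) - (2 * c) *\<^sub>R w u + u"
    have 4: "w (w u) \<bullet> u = 2 * c * c - 1" "w (w u) \<bullet> w u = c" "w u \<bullet> u = c" "u \<bullet> w u = c"
      using 1 2 by (simp_all add: inner_commute c_def)
    have "z \<bullet> z = 0"
      by (simp add: z_def inner_add_left inner_add_right inner_diff_left inner_diff_right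
          1 2 3 4 wuu uu)
    hence "z = 0" by simp
    thus ?thesis by (simp add: z_def algebra_simps)
  qed
  show ?thesis
  proof (cases "c = - 1")
    case True
    have neg: "w x = - x" if "x \<in> V" for x
    proof -
      have "(w x + x) \<bullet> (w x + x) \<le> 0"
        using le [OF that] True
        by (simp add: inner_add_left inner_add_right iso inner_commute)
      hence "w x + x = 0" by (metis inner_gt_zero_iff not_less)
      thus ?thesis by (simp add: eq_neg_iff_add_eq_0)
    qed
    have sin: "sin \<theta> = 0" using cos True th by (metis cos_pi cos_inj_pi less_imp_le order_refl pi_ge_zero sin_pi)
    obtain v where v: "v \<in> V" "v \<bullet> v = 1" "u \<bullet> v = 0" using big(2) [OF uV] by blast
    show ?thesis
      by (rule that [of u v \<theta>]) (use v uV uu th neg sin cos True le in auto)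
  next
    case False
    define s where "s = sin \<theta>"
    have s2: "s * s = 1 - c * c"
      using sin_cos_squared_add [of \<theta>] by (simp add: s_def cos power2_eq_square)
    have "s \<noteq> 0"
    proof
      assume "s = 0"
      hence "c * c = 1" using s2 by simp
      hence "c = 1 \<or> c = - 1" by (simp add: square_eq_1_iff)
      with False c_ne show False by blast
    qed
    define v where "v = (1 / s) *\<^sub>R (w u - c *\<^sub>R u)"
    have sv: "s *\<^sub>R v = w u - c *\<^sub>R u" using \<open>s \<noteq> 0\<close> by (simp add: v_def)
    have "(w u - c *\<^sub>R u) \<bullet> (w u - c *\<^sub>R u) = s * s"
      using wuu uu s2
      by (simp add: inner_diff_left inner_diff_right inner_commute [of "w u" u] c_def [symmetric])
    hence vv: "v \<bullet> v = 1" using \<open>s \<noteq> 0\<close> by (simp add: v_def)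
    have uv: "u \<bullet> v = 0" by (simp add: v_def inner_diff_right uu c_def)
    have vV: "v \<in> V" using uV V by (simp add: v_def subspace_scale subspace_diff)
    have wu: "w u = c *\<^sub>R u + s *\<^sub>R v" by (simp add: sv)
    have "s *\<^sub>R w v = w (w u) - c *\<^sub>R w u"
      using arg_cong [OF sv, of w] by (simp add: linear_diff [OF lin] linear_cmul [OF lin])
    also have "\<dots> = c *\<^sub>R w u - u"
      unfolding wwu by (simp add: algebra_simps flip: scaleR_add_left)
    also have "\<dots> = s *\<^sub>R (c *\<^sub>R v - s *\<^sub>R u)"
      unfolding wu by (simp add: algebra_simps s2)
    finally have wv: "w v = c *\<^sub>R v - s *\<^sub>R u" using \<open>s \<noteq> 0\<close> by simp
    show ?thesis
      by (rule that [of u v \<theta>]) (use uV vV uu vv uv th wu wv le cos s_def in auto)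
  qed
qed

definition double_rotation :: "(real ^ 4 \<Rightarrow> real ^ 4) \<Rightarrow> real \<Rightarrow> real \<Rightarrow>
    real ^ 4 \<Rightarrow> real ^ 4 \<Rightarrow> real ^ 4 \<Rightarrow> real ^ 4 \<Rightarrow> bool" where
  "double_rotation w \<theta> \<phi> u v p q \<longleftrightarrow> orthonormal4 u v p q \<and>
     w u = cos \<theta> *\<^sub>R u + sin \<theta> *\<^sub>R v \<and> w v = cos \<theta> *\<^sub>R v - sin \<theta> *\<^sub>R u \<and>
     w p = cos \<phi> *\<^sub>R p + sin \<phi> *\<^sub>R q \<and> w q = cos \<phi> *\<^sub>R q - sin \<phi> *\<^sub>R p"

lemma double_rotation_exists:
  fixes w :: "real ^ 4 \<Rightarrow> real ^ 4"
  assumes lin: "linear w" and iso: "\<And>x y. w x \<bullet> w y = x \<bullet> y"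
    and fix0: "\<And>x. w x = x \<Longrightarrow> x = 0"
  obtains u v p q \<theta> \<phi> where "double_rotation w \<theta> \<phi> u v p q"
    "0 < \<theta>" "\<theta> \<le> \<phi>" "\<phi> \<le> pi"
proof -
  obtain u v \<theta> where uv: "u \<bullet> u = 1" "v \<bullet> v = 1" "u \<bullet> v = 0" "0 < \<theta>" "\<theta> \<le> pi"
    and wu: "w u = cos \<theta> *\<^sub>R u + sin \<theta> *\<^sub>R v" and wv: "w v = cos \<theta> *\<^sub>R v - sin \<theta> *\<^sub>R u"
    and max: "\<And>x. x \<bullet> w x \<le> cos \<theta> * (x \<bullet> x)"
  proof (rule invariant_plane [OF lin iso fix0, of UNIV])
    show "\<exists>u\<in>(UNIV :: (real ^ 4) set). u \<bullet> u = 1"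
      using exists_orthogonal_unit [of "{}"] by auto
    show "\<exists>v\<in>UNIV. v \<bullet> v = 1 \<and> u \<bullet> v = 0" for u :: "real ^ 4"
      using exists_orthogonal_unit [of "{u}"] by (auto simp: inner_commute)
  qed auto
  have cs: "cos \<theta> * cos \<theta> + sin \<theta> * sin \<theta> = 1"
    using sin_cos_squared_add3 .
  have u_eq: "u = w (cos \<theta> *\<^sub>R u - sin \<theta> *\<^sub>R v)" and v_eq: "v = w (sin \<theta> *\<^sub>R u + cos \<theta> *\<^sub>R v)"
    using cs by (simp_all add: linear_add [OF lin] linear_diff [OF lin] linear_cmul [OF lin] wu wv
        algebra_simps flip: scaleR_add_left)
  let ?V = "{x. x \<bullet> u = 0 \<and> x \<bullet> v = 0}"
  obtain p q \<phi> where "p \<in> ?V" "q \<in> ?V" "p \<bullet> p = 1" "q \<bullet> q = 1" "p \<bullet> q = 0" "0 < \<phi>" "\<phi> \<le> pi"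
    "w p = cos \<phi> *\<^sub>R p + sin \<phi> *\<^sub>R q" "w q = cos \<phi> *\<^sub>R q - sin \<phi> *\<^sub>R p"
  proof (rule invariant_plane [OF lin iso fix0, of ?V])
    show "subspace ?V"
      by (auto simp: subspace_def inner_add_left)
    show "w x \<in> ?V" if "x \<in> ?V" for x
    proof -
      have "w x \<bullet> u = 0"
        using that by (subst u_eq) (simp add: iso inner_diff_right)
      moreover have "w x \<bullet> v = 0"
        using that by (subst v_eq) (simp add: iso inner_add_right)
      ultimately show ?thesis by simp
    qed
    have c2: "card {u, v} \<le> 3" by (simp add: card_insert_if)
    show "\<exists>x\<in>?V. x \<bullet> x = 1"
      using exists_orthogonal_unit [OF _ c2] by auto
    have c3: "card {u, v, x} \<le> 3" for x by (simp add: card_insert_if)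
    show "\<exists>y\<in>?V. y \<bullet> y = 1 \<and> x \<bullet> y = 0" for x
      using exists_orthogonal_unit [OF _ c3 [of x]] by (auto simp: inner_commute)
  qed auto
  note pq = this
  have "cos \<phi> \<le> cos \<theta>"
    using max [of p] pq by (simp add: inner_add_right)
  hence "\<theta> \<le> \<phi>" using uv pq by (meson cos_mono_le_eq less_imp_le)
  moreover have "double_rotation w \<theta> \<phi> u v p q"
    using uv wu wv pq by (simp add: double_rotation_def orthonormal4_def inner_commute)
  ultimately show ?thesis using that uv pq by blast
qed

section \<open>The versor of a double rotation\<close>

lemma reflection_pair_rotation:
  assumes uv: "u \<bullet> u = 1" "v \<bullet> v = 1" "u \<bullet> v = 0"
  shows "reflection (cos \<alpha> *\<^sub>R u + sin \<alpha> *\<^sub>R v) (reflection u x) =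
    x + ((cos (2 * \<alpha>) - 1) * (u \<bullet> x) - sin (2 * \<alpha>) * (v \<bullet> x)) *\<^sub>R u
      + ((cos (2 * \<alpha>) - 1) * (v \<bullet> x) + sin (2 * \<alpha>) * (u \<bullet> x)) *\<^sub>R v"
proof -
  have vu: "v \<bullet> u = 0" using uv by (simp add: inner_commute)
  have cs: "sin \<alpha> * sin \<alpha> = 1 - cos \<alpha> * cos \<alpha>"
    using sin_cos_squared_add3 [of \<alpha>] by linarith
  let ?a = "cos \<alpha> *\<^sub>R u + sin \<alpha> *\<^sub>R v"
  have aa: "?a \<bullet> ?a = 1"
    using uv vu cs by (simp add: inner_add_left inner_add_right)
  have ru: "reflection u x = x - (2 * (u \<bullet> x)) *\<^sub>R u"
    by (simp add: reflection_def uv)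
  have "?a \<bullet> reflection u x = sin \<alpha> * (v \<bullet> x) - cos \<alpha> * (u \<bullet> x)"
    using uv vu by (simp add: ru inner_add_left inner_diff_right algebra_simps)
  hence "reflection ?a (reflection u x)
      = x - (2 * (u \<bullet> x)) *\<^sub>R u - (2 * (sin \<alpha> * (v \<bullet> x) - cos \<alpha> * (u \<bullet> x))) *\<^sub>R ?a"
    by (simp add: reflection_def [of ?a] aa ru)
  also have "\<dots> = x + (- 2 * (u \<bullet> x) - 2 * (sin \<alpha> * (v \<bullet> x) - cos \<alpha> * (u \<bullet> x)) * cos \<alpha>) *\<^sub>R u
      + (- 2 * (sin \<alpha> * (v \<bullet> x) - cos \<alpha> * (u \<bullet> x)) * sin \<alpha>) *\<^sub>R v"
    by (simp add: algebra_simps)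
  also have "- 2 * (u \<bullet> x) - 2 * (sin \<alpha> * (v \<bullet> x) - cos \<alpha> * (u \<bullet> x)) * cos \<alpha>
      = (cos (2 * \<alpha>) - 1) * (u \<bullet> x) - sin (2 * \<alpha>) * (v \<bullet> x)"
    unfolding cos_double_cos sin_double power2_eq_square by (simp add: algebra_simps)
  also have "- 2 * (sin \<alpha> * (v \<bullet> x) - cos \<alpha> * (u \<bullet> x)) * sin \<alpha>
      = (cos (2 * \<alpha>) - 1) * (v \<bullet> x) + sin (2 * \<alpha>) * (u \<bullet> x)"
  proof -
    have "- 2 * (sin \<alpha> * (v \<bullet> x) - cos \<alpha> * (u \<bullet> x)) * sin \<alpha>
        = - 2 * (sin \<alpha> * sin \<alpha>) * (v \<bullet> x) + 2 * (sin \<alpha> * cos \<alpha>) * (u \<bullet> x)"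
      by (simp add: algebra_simps)
    also have "\<dots> = (cos (2 * \<alpha>) - 1) * (v \<bullet> x) + sin (2 * \<alpha>) * (u \<bullet> x)"
      unfolding cs cos_double_cos sin_double power2_eq_square by (simp add: algebra_simps)
    finally show ?thesis .
  qed
  finally show ?thesis .
qed

text \<open>
  Reflecting in two unit vectors at angle \<open>\<theta>/2\<close> rotates their plane by \<open>\<theta>\<close>, so the reflections in these
  four vectors compose to the double rotation by \<open>\<theta>\<close> and \<open>\<phi>\<close>. In general they are not roots of the root system.
\<close>

definition half_rotation_roots :: "real \<Rightarrow> real \<Rightarrow>
    real ^ 4 \<Rightarrow> real ^ 4 \<Rightarrow> real ^ 4 \<Rightarrow> real ^ 4 \<Rightarrow> (real ^ 4) list" where
  "half_rotation_roots \<theta> \<phi> u v p q =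
    [u, cos (\<theta> / 2) *\<^sub>R u + sin (\<theta> / 2) *\<^sub>R v, p, cos (\<phi> / 2) *\<^sub>R p + sin (\<phi> / 2) *\<^sub>R q]"

lemma double_rotation_apply:
  assumes "linear w" "double_rotation w \<theta> \<phi> u v p q"
  shows "w x = ((u \<bullet> x) * cos \<theta> - (v \<bullet> x) * sin \<theta>) *\<^sub>R u + ((u \<bullet> x) * sin \<theta> + (v \<bullet> x) * cos \<theta>) *\<^sub>R v
    + ((p \<bullet> x) * cos \<phi> - (q \<bullet> x) * sin \<phi>) *\<^sub>R p + ((p \<bullet> x) * sin \<phi> + (q \<bullet> x) * cos \<phi>) *\<^sub>R q"
proof -
  have fr: "orthonormal4 u v p q" using assms by (simp add: double_rotation_def)
  have "w x = (x \<bullet> u) *\<^sub>R w u + (x \<bullet> v) *\<^sub>R w v + (x \<bullet> p) *\<^sub>R w p + (x \<bullet> q) *\<^sub>R w q"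
    by (subst orthonormal4_expand [OF fr, of x])
      (simp add: linear_add [OF assms(1)] linear_cmul [OF assms(1)])
  also have "\<dots> = ((u \<bullet> x) * cos \<theta> - (v \<bullet> x) * sin \<theta>) *\<^sub>R u + ((u \<bullet> x) * sin \<theta> + (v \<bullet> x) * cos \<theta>) *\<^sub>R v
    + ((p \<bullet> x) * cos \<phi> - (q \<bullet> x) * sin \<phi>) *\<^sub>R p + ((p \<bullet> x) * sin \<phi> + (q \<bullet> x) * cos \<phi>) *\<^sub>R q"
  proof -
    have rot: "w u = cos \<theta> *\<^sub>R u + sin \<theta> *\<^sub>R v" "w v = cos \<theta> *\<^sub>R v - sin \<theta> *\<^sub>R u"
      "w p = cos \<phi> *\<^sub>R p + sin \<phi> *\<^sub>R q" "w q = cos \<phi> *\<^sub>R q - sin \<phi> *\<^sub>R p"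
      using assms(2) by (simp_all add: double_rotation_def)
    show ?thesis unfolding rot by (simp add: inner_commute [of x] algebra_simps)
  qed
  finally show ?thesis .
qed

lemma coxeter_element_half_rotation_roots:
  assumes lin: "linear w" and dr: "double_rotation w \<theta> \<phi> u v p q"
  shows "coxeter_element (half_rotation_roots \<theta> \<phi> u v p q) = w"
proof
  fix x
  have fr: "orthonormal4 u v p q" using dr by (simp add: double_rotation_def)
  note fr' = fr [unfolded orthonormal4_def]
  have com: "p \<bullet> u = 0" "p \<bullet> v = 0" "q \<bullet> u = 0" "q \<bullet> v = 0"
    using fr' by (simp_all add: inner_commute)
  have "coxeter_element (half_rotation_roots \<theta> \<phi> u v p q) x
      = x + ((cos \<theta> - 1) * (u \<bullet> x) - sin \<theta> * (v \<bullet> x)) *\<^sub>R u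
          + ((cos \<theta> - 1) * (v \<bullet> x) + sin \<theta> * (u \<bullet> x)) *\<^sub>R v
          + ((cos \<phi> - 1) * (p \<bullet> x) - sin \<phi> * (q \<bullet> x)) *\<^sub>R p
          + ((cos \<phi> - 1) * (q \<bullet> x) + sin \<phi> * (p \<bullet> x)) *\<^sub>R q"
    using fr' com reflection_pair_rotation [of u v "\<theta> / 2"] reflection_pair_rotation [of p q "\<phi> / 2"]
    by (simp add: coxeter_element_def half_rotation_roots_def inner_add_right)
  also have "\<dots> = w x"
    unfolding double_rotation_apply [OF lin dr, of x]
    by (subst (1) orthonormal4_expand [OF fr, of x]) (simp add: inner_commute [of x] algebra_simps)
  finally show "coxeter_element (half_rotation_roots \<theta> \<phi> u v p q) x = w x" .
qed

lemma zero_notin_half_rotation_roots: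
  assumes "orthonormal4 u v p q"
  shows "0 \<notin> set (half_rotation_roots \<theta> \<phi> u v p q)"
proof -
  have "a \<noteq> 0 \<and> cos \<alpha> *\<^sub>R a + sin \<alpha> *\<^sub>R b \<noteq> 0"
    if "a \<bullet> a = 1" "b \<bullet> b = 1" "a \<bullet> b = 0" for a b :: "real ^ 4" and \<alpha>
  proof -
    have "(cos \<alpha> *\<^sub>R a + sin \<alpha> *\<^sub>R b) \<bullet> (cos \<alpha> *\<^sub>R a + sin \<alpha> *\<^sub>R b) = 1"
      using that by (simp add: inner_add_left inner_add_right inner_commute [of b a])
    thus ?thesis using that by auto
  qed
  thus ?thesis
    using assms unfolding orthonormal4_def half_rotation_roots_def by fastforce
qed

lemma bivector_square:
  assumes "u \<bullet> u = 1" "v \<bullet> v = 1" "u \<bullet> v = 0"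
  shows "(cvec u * cvec v) * (cvec u * cvec v) = - 1"
proof (rule unit_bivector_square)
  show "unit_bivector (span {u, v}) (cvec u * cvec v)"
    using assms by (auto simp: unit_bivector_def orthonormal_basis2_def norm_eq_1)
qed

lemma cvec_mult_half_rotated:
  assumes uv: "u \<bullet> u = 1" "v \<bullet> v = 1" "u \<bullet> v = 0"
  shows "cvec (sgn u) * cvec (sgn (cos \<alpha> *\<^sub>R u + sin \<alpha> *\<^sub>R v)) = exp (\<alpha> *\<^sub>R (cvec u * cvec v))"
proof -
  have "(cos \<alpha> *\<^sub>R u + sin \<alpha> *\<^sub>R v) \<bullet> (cos \<alpha> *\<^sub>R u + sin \<alpha> *\<^sub>R v) = 1"
    using uv by (simp add: inner_add_left inner_add_right inner_commute [of v u])
  hence "sgn u = u" "sgn (cos \<alpha> *\<^sub>R u + sin \<alpha> *\<^sub>R v) = cos \<alpha> *\<^sub>R u + sin \<alpha> *\<^sub>R v"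
    using uv by (simp_all add: sgn_div_norm norm_eq_sqrt_inner)
  thus ?thesis
    by (simp add: exp_imaginary_unit [OF bivector_square [OF uv]] linear_add [OF linear_cvec]
        linear_cmul [OF linear_cvec] distrib_left cvec_square uv)
qed

lemma versor_half_rotation_roots:
  assumes "orthonormal4 u v p q"
  shows "versor (half_rotation_roots \<theta> \<phi> u v p q)
    = exp ((\<theta> / 2) *\<^sub>R (cvec u * cvec v)) * exp ((\<phi> / 2) *\<^sub>R (cvec p * cvec q))"
proof -
  have "versor (half_rotation_roots \<theta> \<phi> u v p q)
    = (cvec (sgn u) * cvec (sgn (cos (\<theta> / 2) *\<^sub>R u + sin (\<theta> / 2) *\<^sub>R v)))
      * (cvec (sgn p) * cvec (sgn (cos (\<phi> / 2) *\<^sub>R p + sin (\<phi> / 2) *\<^sub>R q)))"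
    by (simp add: versor_def half_rotation_roots_def mult.assoc)
  thus ?thesis
    using assms by (simp add: orthonormal4_def cvec_mult_half_rotated)
qed

lemma scalar_part_half_rotation_roots:
  assumes fr: "orthonormal4 u v p q"
  shows "blade_inner 1 (versor (half_rotation_roots \<theta> \<phi> u v p q)) = cos (\<theta> / 2) * cos (\<phi> / 2)"
proof -
  note fr' = fr [unfolded orthonormal4_def]
  have "exp ((\<theta> / 2) *\<^sub>R (cvec u * cvec v)) = cos (\<theta> / 2) *\<^sub>R 1 + sin (\<theta> / 2) *\<^sub>R (cvec u * cvec v)"
    "exp ((\<phi> / 2) *\<^sub>R (cvec p * cvec q)) = cos (\<phi> / 2) *\<^sub>R 1 + sin (\<phi> / 2) *\<^sub>R (cvec p * cvec q)"
    using fr' by (auto intro!: exp_imaginary_unit bivector_square)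
  thus ?thesis
    using fr' blade_inner_one_vectors4 [of u v p q]
    by (simp add: versor_half_rotation_roots [OF fr] distrib_left distrib_right
        blade_inner_add_right blade_inner_scaleR_right blade_inner_one_vectors2 mult.assoc)
qed

text \<open>
  The four reflections in any orthonormal basis compose to \<open>- id\<close>, so by uniqueness of versors the
  product of the basis is the pseudoscalar up to sign; multiply by \<open>uv\<close>, whose square is \<open>- 1\<close>.
\<close>

lemma pseudoscalar_mult_bivector:
  assumes fr: "orthonormal4 u v p q"
  shows "pseudoscalar * (cvec u * cvec v) = cvec p * cvec q \<or>
    pseudoscalar * (cvec u * cvec v) = - (cvec p * cvec q)"
proof -
  have frame: "coxeter_element [a, b, c, d] = uminus \<and> versor [a, b, c, d] = cvec a * cvec b * cvec c * cvec d
      \<and> 0 \<notin> set [a, b, c, d]"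
    if "orthonormal4 a b c d" for a b c d
  proof (intro conjI ext)
    note fr = that [unfolded orthonormal4_def]
    have com: "b \<bullet> a = 0" "c \<bullet> a = 0" "d \<bullet> a = 0" "c \<bullet> b = 0" "d \<bullet> b = 0" "d \<bullet> c = 0"
      using fr by (simp_all add: inner_commute)
    show "coxeter_element [a, b, c, d] x = - x" for x
    proof -
      have "coxeter_element [a, b, c, d] x
          = x - 2 *\<^sub>R ((x \<bullet> a) *\<^sub>R a + (x \<bullet> b) *\<^sub>R b + (x \<bullet> c) *\<^sub>R c + (x \<bullet> d) *\<^sub>R d)"
        using fr com by (simp add: coxeter_element_def reflection_def inner_diff_right
            inner_commute [of x] algebra_simps)
      also have "\<dots> = x - 2 *\<^sub>R x"
        by (subst orthonormal4_expand [OF that, of x, symmetric]) simp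
      finally show ?thesis by (simp add: scaleR_2)
    qed
    have "sgn a = a" "sgn b = b" "sgn c = c" "sgn d = d"
      using fr by (simp_all add: sgn_div_norm norm_eq_sqrt_inner)
    thus "versor [a, b, c, d] = cvec a * cvec b * cvec c * cvec d"
      by (simp add: versor_def mult.assoc)
    show "0 \<notin> set [a, b, c, d]" using fr by auto
  qed
  let ?e = "\<lambda>i. axis i 1 :: real ^ 4"
  have e: "orthonormal4 (?e 1) (?e 2) (?e 3) (?e 4)"
    by (simp add: orthonormal4_def inner_axis_axis)
  have I: "versor [?e 1, ?e 2, ?e 3, ?e 4] = pseudoscalar"
    using frame [OF e] by (simp add: cvec_axis pseudoscalar_def)
  have "pseudoscalar = cvec u * cvec v * cvec p * cvec q \<or> pseudoscalar = - (cvec u * cvec v * cvec p * cvec q)"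
    using versor_unique [of "[u, v, p, q]" "[?e 1, ?e 2, ?e 3, ?e 4]"] frame [OF e] frame [OF fr] I
    by simp
  moreover have "cvec u * cvec v * cvec p * cvec q * (cvec u * cvec v) = - (cvec p * cvec q)"
  proof -
    have anti: "cvec y * cvec x = - (cvec x * cvec y)" if "x \<bullet> y = 0" for x y :: "real ^ 4"
      using cvec_anticommutator [of x y] that by (simp add: add_eq_0_iff2 add.commute)
    have anti': "cvec y * (cvec x * z) = - (cvec x * (cvec y * z))" if "x \<bullet> y = 0" for x y :: "real ^ 4" and z
      using anti [OF that] by (simp flip: mult.assoc)
    have "cvec p * cvec q * (cvec u * cvec v) = cvec u * cvec v * (cvec p * cvec q)"
      using fr by (simp add: orthonormal4_def mult.assoc anti [of v p] anti [of v q] anti' [of u p]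
          anti' [of u q] anti' [of v p] anti' [of v q])
    hence "cvec u * cvec v * cvec p * cvec q * (cvec u * cvec v)
        = (cvec u * cvec v) * (cvec u * cvec v) * (cvec p * cvec q)"
      by (simp add: mult.assoc)
    also have "(cvec u * cvec v) * (cvec u * cvec v) = - 1"
      using fr by (intro bivector_square) (simp_all add: orthonormal4_def)
    finally show ?thesis by simp
  qed
  ultimately show ?thesis
  proof (elim disjE)
    let ?N = "cvec u * cvec v * cvec p * cvec q"
    assume N: "?N * (cvec u * cvec v) = - (cvec p * cvec q)"
    show ?thesis if "pseudoscalar = ?N"
      unfolding that N by (rule disjI2) (rule refl)
    show ?thesis if "pseudoscalar = - ?N"
      unfolding that mult_minus_left N minus_minus by (rule disjI1) (rule refl)
  qed
qed

lemma unit_bivector_orthogonal_plane: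
  assumes "unit_bivector P B"
  shows "unit_bivector (P\<^sup>\<bottom>) (pseudoscalar * B)"
proof -
  obtain u v where uv: "norm u = 1" "norm v = 1" "u \<bullet> v = 0" and P: "P = span {u, v}"
    and B: "B = cvec u * cvec v"
    using assms by (auto simp: unit_bivector_def orthonormal_basis2_def)
  obtain p q where fr: "orthonormal4 u v p q"
    using orthonormal4_extend [OF uv] .
  note fr' = fr [unfolded orthonormal4_def]
  have com: "p \<bullet> u = 0" "p \<bullet> v = 0" "q \<bullet> u = 0" "q \<bullet> v = 0" "q \<bullet> p = 0"
    using fr' by (simp_all add: inner_commute)
  have perp: "P\<^sup>\<bottom> = span {p, q}"
  proof (intro equalityI subsetI)
    fix x assume "x \<in> P\<^sup>\<bottom>"
    hence "x \<bullet> u = 0" "x \<bullet> v = 0"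
      by (auto simp: orthogonal_comp_def orthogonal_def P span_base inner_commute)
    with orthonormal4_expand [OF fr, of x] have "x = (x \<bullet> p) *\<^sub>R p + (x \<bullet> q) *\<^sub>R q" by simp
    moreover have "(x \<bullet> p) *\<^sub>R p + (x \<bullet> q) *\<^sub>R q \<in> span {p, q}"
      by (intro span_add span_scale span_base) auto
    ultimately show "x \<in> span {p, q}" by simp
  next
    fix x assume x: "x \<in> span {p, q}"
    have "orthogonal y x" if "y \<in> P" for y
    proof -
      have "orthogonal z y" if "z \<in> {p, q}" for z
        using \<open>y \<in> P\<close> that com unfolding P
        by (intro orthogonal_to_span [of y "{u, v}"]) (auto simp: orthogonal_def)
      thus ?thesis
        using x by (intro orthogonal_to_span [of x "{p, q}"]) (auto simp: orthogonal_commute)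
    qed
    thus "x \<in> P\<^sup>\<bottom>" by (simp add: orthogonal_comp_def)
  qed
  have "- (cvec p * cvec q) = cvec q * cvec p"
    using cvec_anticommutator [of p q] fr' by (simp add: add_eq_0_iff2 add_eq_0_iff)
  with pseudoscalar_mult_bivector [OF fr]
  consider "pseudoscalar * B = cvec p * cvec q" | "pseudoscalar * B = cvec q * cvec p"
    by (auto simp: B)
  thus ?thesis
  proof cases
    case 1
    with perp fr' show ?thesis
      by (auto simp: unit_bivector_def orthonormal_basis2_def norm_eq_1)
  next
    case 2
    with perp fr' com show ?thesis
      unfolding unit_bivector_def orthonormal_basis2_def
      by (intro exI [of _ q] exI [of _ p]) (auto simp: norm_eq_1 insert_commute)
  qed
qed

lemma span_pair: "x \<in> span {u, v} \<longleftrightarrow> (\<exists>a b. x = a *\<^sub>R u + b *\<^sub>R v)"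
proof -
  have "x - a *\<^sub>R u = b *\<^sub>R v \<longleftrightarrow> x = a *\<^sub>R u + b *\<^sub>R v" for a b
    by (metis add.commute diff_eq_eq)
  thus ?thesis by (auto simp add: span_insert span_singleton image_iff)
qed

text \<open>
  The change of orthonormal basis multiplies the bivector by its determinant, which is \<open>\<plusminus> 1\<close>.
\<close>

lemma unit_bivector_unique:
  assumes "unit_bivector P B" "unit_bivector P C"
  shows "B = C \<or> B = - C"
proof -
  obtain u v where uv: "u \<bullet> u = 1" "v \<bullet> v = 1" "u \<bullet> v = 0" and P: "P = span {u, v}"
    and C: "C = cvec u * cvec v"
    using assms(2) by (auto simp: unit_bivector_def orthonormal_basis2_def norm_eq_1)
  obtain x y where xy: "x \<bullet> x = 1" "y \<bullet> y = 1" "x \<bullet> y = 0" and "P = span {x, y}"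
    and B: "B = cvec x * cvec y"
    using assms(1) by (auto simp: unit_bivector_def orthonormal_basis2_def norm_eq_1)
  hence "x \<in> span {u, v}" "y \<in> span {u, v}" using P by (auto intro: span_base)
  then obtain a b c d where x: "x = a *\<^sub>R u + b *\<^sub>R v" and y: "y = c *\<^sub>R u + d *\<^sub>R v"
    by (metis span_pair)
  have vu: "cvec v * cvec u = - (cvec u * cvec v)"
    using cvec_anticommutator [of u v] uv by (simp add: add_eq_0_iff2 add.commute)
  have dots: "a * a + b * b = 1" "c * c + d * d = 1" "a * c + b * d = 0"
    using xy uv unfolding x y
    by (simp_all add: inner_add_left inner_add_right inner_commute [of v u] mult.commute)
  have "B = (a * c + b * d) *\<^sub>R 1 + (a * d - b * c) *\<^sub>R C"
  proof -
    have "B = (a * c) *\<^sub>R (cvec u * cvec u) + (a * d) *\<^sub>R (cvec u * cvec v)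
        + ((b * c) *\<^sub>R (cvec v * cvec u) + (b * d) *\<^sub>R (cvec v * cvec v))"
      by (simp add: B x y linear_add [OF linear_cvec] linear_cmul [OF linear_cvec]
          distrib_left distrib_right scaleR_add_right mult.commute)
    thus ?thesis
      by (simp add: vu C cvec_square uv scaleR_add_left scaleR_diff_left)
  qed
  hence BC: "B = (a * d - b * c) *\<^sub>R C" by (simp add: dots)
  have "(a * d - b * c) * (a * d - b * c) = (a * a + b * b) * (c * c + d * d) - (a * c + b * d) * (a * c + b * d)"
    by (simp add: algebra_simps)
  hence "(a * d - b * c) * (a * d - b * c) = 1" by (simp add: dots)
  hence "a * d - b * c = 1 \<or> a * d - b * c = - 1"
    by (simp add: square_eq_1_iff)
  thus ?thesis by (auto simp: BC)
qed

section \<open>Order, invariant planes and eigenvalues of a double rotation\<close>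

lemma double_rotation_funpow:
  assumes lin: "linear w" and dr: "double_rotation w \<theta> \<phi> u v p q"
  shows "linear (w ^^ n) \<and> double_rotation (w ^^ n) (n * \<theta>) (n * \<phi>) u v p q"
proof (induction n)
  case 0
  have "linear (w ^^ 0)" by (rule linearI) simp_all
  thus ?case using dr by (simp add: double_rotation_def id_def)
next
  case (Suc n)
  have rot: "w u = cos \<theta> *\<^sub>R u + sin \<theta> *\<^sub>R v" "w v = cos \<theta> *\<^sub>R v - sin \<theta> *\<^sub>R u"
      "w p = cos \<phi> *\<^sub>R p + sin \<phi> *\<^sub>R q" "w q = cos \<phi> *\<^sub>R q - sin \<phi> *\<^sub>R p"
    using dr by (simp_all add: double_rotation_def)
  have "linear (w ^^ Suc n)"
    using Suc lin by (simp add: linear_compose)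
  moreover have "double_rotation (w ^^ Suc n) (Suc n * \<theta>) (Suc n * \<phi>) u v p q"
  proof -
    have pow: "(w ^^ n) u = cos (n * \<theta>) *\<^sub>R u + sin (n * \<theta>) *\<^sub>R v"
      "(w ^^ n) v = cos (n * \<theta>) *\<^sub>R v - sin (n * \<theta>) *\<^sub>R u"
      "(w ^^ n) p = cos (n * \<phi>) *\<^sub>R p + sin (n * \<phi>) *\<^sub>R q"
      "(w ^^ n) q = cos (n * \<phi>) *\<^sub>R q - sin (n * \<phi>) *\<^sub>R p"
      and fr: "orthonormal4 u v p q"
      using Suc by (simp_all add: double_rotation_def)
    have Suc_mult: "real (Suc n) * \<alpha> = \<alpha> + real n * \<alpha>" for \<alpha>
      by (simp add: distrib_right)
    show ?thesis
      unfolding double_rotation_def Suc_mult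
      by (simp add: pow fr linear_add [OF lin] linear_diff [OF lin] linear_cmul [OF lin] rot
          cos_add sin_add scaleR_add_right scaleR_diff_right scaleR_add_left
          scaleR_diff_left algebra_simps)
  qed
  ultimately show ?case ..
qed

lemma double_rotation_eq_id_iff:
  assumes lin: "linear w" and dr: "double_rotation w \<theta> \<phi> u v p q"
  shows "w = id \<longleftrightarrow> cos \<theta> = 1 \<and> cos \<phi> = 1"
proof
  have fr: "orthonormal4 u v p q" using dr by (simp add: double_rotation_def)
  assume "w = id"
  hence "u = cos \<theta> *\<^sub>R u + sin \<theta> *\<^sub>R v" "p = cos \<phi> *\<^sub>R p + sin \<phi> *\<^sub>R q"
    using dr by (simp_all add: double_rotation_def)
  hence "u \<bullet> u = u \<bullet> (cos \<theta> *\<^sub>R u + sin \<theta> *\<^sub>R v)" "p \<bullet> p = p \<bullet> (cos \<phi> *\<^sub>R p + sin \<phi> *\<^sub>R q)"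
    by simp_all
  thus "cos \<theta> = 1 \<and> cos \<phi> = 1"
    using fr by (simp add: orthonormal4_def inner_add_right)
next
  have fr: "orthonormal4 u v p q" using dr by (simp add: double_rotation_def)
  assume cos: "cos \<theta> = 1 \<and> cos \<phi> = 1"
  hence sin: "sin \<theta> = 0" "sin \<phi> = 0" by (simp_all add: cos_one_sin_zero)
  show "w = id"
  proof
    fix x
    have "w x = (x \<bullet> u) *\<^sub>R u + (x \<bullet> v) *\<^sub>R v + (x \<bullet> p) *\<^sub>R p + (x \<bullet> q) *\<^sub>R q"
      using double_rotation_apply [OF lin dr, of x] by (simp add: cos sin inner_commute)
    thus "w x = id x"
      using orthonormal4_expand [OF fr, of x] by simp
  qed
qed

lemma coxeter_number_double_rotation:
  fixes h m :: nat
  assumes "linear w" "double_rotation w (2 * pi / h) (2 * pi * m / h) u v p q" "0 < h"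
  shows "coxeter_number w = h"
  unfolding coxeter_number_def
proof (rule Least_equality)
  have pow: "w ^^ n = id \<longleftrightarrow> cos (n * (2 * pi / h)) = 1 \<and> cos (n * (2 * pi * m / h)) = 1" for n
    using double_rotation_funpow [OF assms(1,2)] double_rotation_eq_id_iff by blast
  have "cos (2 * pi) = 1" "cos (2 * pi * real m) = 1"
    by (simp_all add: cos_one_2pi_int) (metis mult.commute of_int_of_nat_eq)
  thus "0 < h \<and> w ^^ h = id"
    using \<open>0 < h\<close> by (simp add: pow)
  show "h \<le> n" if n: "0 < n \<and> w ^^ n = id" for n
  proof (rule ccontr)
    assume "\<not> h \<le> n"
    have "cos (n * (2 * pi / h)) = 1" using n pow by blast
    then obtain k :: int where "n * (2 * pi / h) = k * 2 * pi"
      by (auto simp: cos_one_2pi_int)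
    hence "real n = k * real h" using \<open>0 < h\<close> by (simp add: field_simps)
    hence "int n = k * int h" by (metis of_int_eq_iff of_int_mult of_int_of_nat_eq)
    hence "h dvd n" by (metis dvd_triv_right int_dvd_int_iff)
    with n \<open>\<not> h \<le> n\<close> show False by (auto dest: dvd_imp_le)
  qed
qed

text \<open>
  A vector \<open>z\<close> of a plane rotated by \<open>\<theta>\<close> satisfies \<open>w (w z) = 2 cos \<theta> w z - z\<close>. Its component in the
  plane of \<open>p\<close> and \<open>q\<close> satisfies the same recurrence with \<open>\<phi>\<close>, so the difference of the cosines
  annihilates it.
\<close>

lemma rotates_plane_unique:
  assumes lin: "linear w" and dr: "double_rotation w \<theta> \<phi> u v p q"
    and ne: "cos \<theta> \<noteq> cos \<phi>" and rot: "rotates_plane w \<theta> P"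
  shows "P = span {u, v}"
proof -
  have fr: "orthonormal4 u v p q" using dr by (simp add: double_rotation_def)
  note fr' = fr [unfolded orthonormal4_def]
  have com: "p \<bullet> u = 0" "p \<bullet> v = 0" "q \<bullet> u = 0" "q \<bullet> v = 0" "q \<bullet> p = 0"
    using fr' by (simp_all add: inner_commute)
  obtain x y where xy: "norm x = 1" "norm y = 1" "x \<bullet> y = 0" and P: "P = span {x, y}"
    and wx: "w x = cos \<theta> *\<^sub>R x + sin \<theta> *\<^sub>R y" and wy: "w y = cos \<theta> *\<^sub>R y - sin \<theta> *\<^sub>R x"
    using rot by (auto simp: rotates_plane_def orthonormal_basis2_def)
  have pw: "p \<bullet> w z = cos \<phi> * (p \<bullet> z) - sin \<phi> * (q \<bullet> z)"
    and qw: "q \<bullet> w z = sin \<phi> * (p \<bullet> z) + cos \<phi> * (q \<bullet> z)" for z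
    using fr' com by (simp_all add: double_rotation_apply [OF lin dr, of z] inner_add_right mult.commute)
  have cs: "cos \<alpha> * cos \<alpha> + sin \<alpha> * sin \<alpha> = 1" for \<alpha> :: real
    by (rule sin_cos_squared_add3)
  have in_span: "z \<in> span {u, v}" if rec: "w (w z) = (2 * cos \<theta>) *\<^sub>R w z - z" for z
  proof -
    have "p \<bullet> w (w z) = 2 * cos \<phi> * (p \<bullet> w z) - (cos \<phi> * cos \<phi> + sin \<phi> * sin \<phi>) * (p \<bullet> z)"
      "q \<bullet> w (w z) = 2 * cos \<phi> * (q \<bullet> w z) - (cos \<phi> * cos \<phi> + sin \<phi> * sin \<phi>) * (q \<bullet> z)"
      by (simp_all only: pw qw) algebra+
    hence "(cos \<theta> - cos \<phi>) * (p \<bullet> w z) = 0" "(cos \<theta> - cos \<phi>) * (q \<bullet> w z) = 0"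
      unfolding cs by (simp_all add: rec inner_diff_right algebra_simps)
    hence 0: "p \<bullet> w z = 0" "q \<bullet> w z = 0" using ne by simp_all
    have "p \<bullet> w (w z) = 0" "q \<bullet> w (w z) = 0"
      by (simp_all add: pw [of "w z"] qw [of "w z"] 0)
    hence "p \<bullet> z = 0" "q \<bullet> z = 0"
      by (simp_all add: rec inner_diff_right 0)
    hence "z = (z \<bullet> u) *\<^sub>R u + (z \<bullet> v) *\<^sub>R v"
      using orthonormal4_expand [OF fr, of z] by (simp add: inner_commute [of z])
    thus ?thesis unfolding span_pair by blast
  qed
  have sn: "sin \<theta> * sin \<theta> = 1 - cos \<theta> * cos \<theta>" using cs [of \<theta>] by linarith
  have "w (w x) = (2 * cos \<theta>) *\<^sub>R w x - x" "w (w y) = (2 * cos \<theta>) *\<^sub>R w y - y"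
    by (simp_all add: wx wy linear_add [OF lin] linear_diff [OF lin] linear_cmul [OF lin]
        vec_eq_iff algebra_simps sn)
  hence "x \<in> span {u, v}" "y \<in> span {u, v}" by (simp_all add: in_span)
  hence sub: "span {x, y} \<subseteq> span {u, v}" by (simp add: span_minimal)
  have "pairwise orthogonal {x, y}" "0 \<notin> {x, y}" "x \<noteq> y"
    using xy by (auto simp: pairwise_def orthogonal_def inner_commute)
  hence "dim {x, y} = 2"
    using dim_eq_card_independent [OF pairwise_orthogonal_independent] by (metis card_2_iff)
  moreover have "dim {u, v} \<le> 2"
    using dim_le_card' [of "{u, v}"] by (simp add: card_insert_if split: if_splits)
  ultimately have "span {x, y} = span {u, v}"
    using sub by (intro subspace_dim_equal) simp_all
  thus ?thesis by (simp add: P)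
qed

text \<open>
  The Hermitian product of \<open>a + i b\<close> and \<open>c + i d\<close> in terms of real inner products.
\<close>

lemma sum_conj_mult:
  fixes a b c d :: "real ^ 'n"
  shows "(\<Sum>i\<in>UNIV. (of_real (a $ i) - \<i> * of_real (b $ i)) * (of_real (c $ i) + \<i> * of_real (d $ i)))
    = of_real (a \<bullet> c + b \<bullet> d) + \<i> * of_real (a \<bullet> d - b \<bullet> c)"
  by (simp add: inner_vec_def sum.distrib sum_subtractf sum_distrib_left algebra_simps
      flip: sum.distrib sum_subtractf)

lemma prod_4: "prod f (UNIV :: 4 set) = f 1 * f 2 * f 3 * f 4"
  unfolding UNIV_4 by (simp add: ac_simps)

text \<open>
  The vectors \<open>u - i v\<close>, \<open>u + i v\<close>, \<open>p - i q\<close> and \<open>p + i q\<close> are eigenvectors for the four roots. The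
  matrix \<open>E\<close> with these columns diagonalises \<open>w\<close>, and half of its conjugate transpose is its inverse
  \<open>F\<close>. Conjugating the characteristic matrix itself, over the ring of polynomials, turns its
  determinant into a product of linear factors.
\<close>

lemma complex_charpoly_double_rotation:
  assumes lin: "linear w" and dr: "double_rotation w \<theta> \<phi> u v p q"
  shows "complex_charpoly w = [:- cis \<theta>, 1:] * [:- cis (- \<theta>), 1:] * [:- cis \<phi>, 1:] * [:- cis (- \<phi>), 1:]"
proof -
  note fr = dr [unfolded double_rotation_def orthonormal4_def]
  have com: "p \<bullet> u = 0" "p \<bullet> v = 0" "q \<bullet> u = 0" "q \<bullet> v = 0" "q \<bullet> p = 0" "v \<bullet> u = 0"
    using fr by (simp_all add: inner_commute)
  have rot: "w u = cos \<theta> *\<^sub>R u + sin \<theta> *\<^sub>R v" "w v = cos \<theta> *\<^sub>R v - sin \<theta> *\<^sub>R u"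
      "w p = cos \<phi> *\<^sub>R p + sin \<phi> *\<^sub>R q" "w q = cos \<phi> *\<^sub>R q - sin \<phi> *\<^sub>R p"
    using fr by simp_all
  define re im :: "4 \<Rightarrow> real ^ 4" where
    "re k = (if k = 1 \<or> k = 2 then u else p)" and
    "im k = (if k = 1 then - v else if k = 2 then v else if k = 3 then - q else q)" for k
  define d :: "4 \<Rightarrow> complex" where
    "d k = (if k = 1 then cis \<theta> else if k = 2 then cis (- \<theta>) else if k = 3 then cis \<phi> else cis (- \<phi>))" for k
  define E where "E i k = of_real (re k $ i) + \<i> * of_real (im k $ i)" for i k
  define F where "F k i = (of_real (re k $ i) - \<i> * of_real (im k $ i)) / 2" for i k
  have FE: "(\<Sum>i\<in>UNIV. F k i * E i l) = (if k = l then 1 else 0)" for k l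
  proof -
    have "(\<Sum>i\<in>UNIV. F k i * E i l) = (of_real (re k \<bullet> re l + im k \<bullet> im l)
        + \<i> * of_real (re k \<bullet> im l - im k \<bullet> re l)) / 2"
      unfolding sum_conj_mult [symmetric] F_def E_def sum_divide_distrib by simp
    also have "\<dots> = (if k = l then 1 else 0)"
      using exhaust_4 [of k] exhaust_4 [of l] fr com
      by (elim disjE) (simp_all add: re_def im_def)
    finally show ?thesis .
  qed
  hence EF: "(\<Sum>i\<in>UNIV. E i l * F k i) = (if k = l then 1 else 0)" for k l
    by (simp add: mult.commute)
  have eig: "(\<Sum>j\<in>UNIV. of_real (matrix w $ i $ j) * E j k) = E i k * d k" for i k
  proof -
    have mat: "(\<Sum>j\<in>UNIV. matrix w $ i $ j * z $ j) = w z $ i" for z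
      using arg_cong [OF fun_cong [OF matrix_vector_mul(2) [OF lin], of z], of "\<lambda>y. y $ i"]
      by (simp add: matrix_vector_mult_def)
    have "(\<Sum>j\<in>UNIV. of_real (matrix w $ i $ j) * E j k)
        = of_real (\<Sum>j\<in>UNIV. matrix w $ i $ j * re k $ j)
          + \<i> * of_real (\<Sum>j\<in>UNIV. matrix w $ i $ j * im k $ j)"
      by (simp add: E_def distrib_left sum.distrib sum_distrib_left mult_ac)
    also have "\<dots> = of_real (w (re k) $ i) + \<i> * of_real (w (im k) $ i)"
      by (simp add: mat)
    also have "\<dots> = E i k * d k"
      using exhaust_4 [of k]
      by (elim disjE) (simp_all add: E_def re_def im_def d_def rot linear_neg [OF lin]
          complex_eq_iff algebra_simps)
    finally show ?thesis .
  qed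
  let ?M = "mat [:0, 1:] - map_matrix (\<lambda>x. [:complex_of_real x:]) (matrix w) :: complex poly ^ 4 ^ 4"
  let ?E = "(\<chi> i k. [:E i k:]) :: complex poly ^ 4 ^ 4"
  let ?F = "(\<chi> k i. [:F k i:]) :: complex poly ^ 4 ^ 4"
  let ?D = "(\<chi> k l. if k = l then [:- d k, 1:] else 0) :: complex poly ^ 4 ^ 4"
  have const: "(\<Sum>i\<in>A. [:f i:]) = [:\<Sum>i\<in>A. f i:]" for f :: "4 \<Rightarrow> complex" and A
    by (induction A rule: infinite_finite_induct) auto
  have "?F ** ?E = mat 1"
    by (simp add: matrix_matrix_mult_def mat_def vec_eq_iff const EF one_pCons)
  hence "det ?F * det ?E = 1"
    by (simp only: det_mul [symmetric] det_I)
  hence detE: "det ?E \<noteq> 0" by auto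
  have "?M ** ?E = ?E ** ?D"
  proof (simp only: vec_eq_iff, intro allI)
    fix i k
    have "(?M ** ?E) $ i $ k = (\<Sum>j\<in>UNIV. (if i = j then [:0, 1:] * [:E j k:] else 0)
        - [:of_real (matrix w $ i $ j) * E j k:])"
      unfolding matrix_matrix_mult_def
      by (simp add: mat_def algebra_simps) (rule sum.cong, auto)
    also have "\<dots> = [:0, 1:] * [:E i k:] - [:E i k * d k:]"
      by (simp add: sum_subtractf const eig)
    also have "\<dots> = [:E i k:] * [:- d k, 1:]"
      by (simp add: algebra_simps)
    also have "\<dots> = (?E ** ?D) $ i $ k"
      by (simp add: matrix_matrix_mult_def if_distrib [of "\<lambda>t. _ * t"] cong: if_cong)
    finally show "(?M ** ?E) $ i $ k = (?E ** ?D) $ i $ k" .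
  qed
  hence "det ?M * det ?E = det ?E * det ?D"
    by (simp only: det_mul [symmetric])
  hence "det ?E * det ?M = det ?E * det ?D"
    by (simp only: mult.commute)
  hence "det ?M = det ?D"
    using detE by (simp only: mult_cancel_left simp_thms)
  also have "det ?D = (\<Prod>k\<in>UNIV. [:- d k, 1:])"
  proof -
    have off: "?D $ k $ l = 0" if "k \<noteq> l" for k l using that by simp
    have diag: "?D $ k $ k = [:- d k, 1:]" for k by simp
    have "det ?D = (\<Prod>k\<in>UNIV. ?D $ k $ k)" by (rule det_diagonal) (rule off)
    thus ?thesis unfolding diag .
  qed
  also have "\<dots> = [:- cis \<theta>, 1:] * [:- cis (- \<theta>), 1:] * [:- cis \<phi>, 1:] * [:- cis (- \<phi>), 1:]"
  proof -
    have d: "d 1 = cis \<theta>" "d 2 = cis (- \<theta>)" "d 3 = cis \<phi>" "d 4 = cis (- \<phi>)"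
      by (simp_all add: d_def)
    show ?thesis unfolding prod_4 d by (rule refl)
  qed
  finally show ?thesis by (simp add: complex_charpoly_def)
qed

lemma order_linear_factor: "order a [:- b, 1:] = (if a = b then 1 else 0)" for a b :: complex
proof (cases "a = b")
  case True
  thus ?thesis using order_power_n_n [of a 1] by simp
next
  case False
  hence "poly [:- b, 1:] a \<noteq> 0" by simp
  with False show ?thesis by (simp add: order_0I)
qed

text \<open>
  The eigenvalues \<open>cis(-2\<pi>k/h)\<close> are the roots of unity with index \<open>h - k\<close>, so each of the two rotations
  contributes a pair of complementary exponents.
\<close>

lemma exponents_double_rotation:
  fixes h m :: nat
  assumes lin: "linear w" and dr: "double_rotation w (2 * pi / h) (2 * pi * m / h) u v p q"
    and m: "0 < m" "m < h" "1 < h"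
  shows "exponents w = {#1, m, h - m, h - 1#}"
proof -
  define \<zeta> where "\<zeta> k = cis (2 * pi * real k / real h)" for k
  have h: "coxeter_number w = h"
    using coxeter_number_double_rotation [OF lin dr] m by simp
  have z_exp: "exp (2 * pi * \<i> * k / h) = \<zeta> k" for k
    by (simp add: \<zeta>_def cis_conv_exp mult_ac)
  have inj: "\<zeta> j = \<zeta> k \<longleftrightarrow> j = k" if "j < h" "k < h" for j k
    using complex_root_unity_eq [of h j k] that m z_exp [of j] z_exp [of k]
    by (simp add: mult_ac)
  have neg: "cis (- (2 * pi * real k / real h)) = \<zeta> (h - k)" if "k < h" for k
  proof -
    have "2 * pi * real (h - k) / real h = 2 * pi - 2 * pi * real k / real h"
      using that m by (simp add: of_nat_diff field_simps)
    thus ?thesis by (simp add: \<zeta>_def complex_eq_iff cos_diff sin_diff)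
  qed
  have cp: "complex_charpoly w = [:- \<zeta> 1, 1:] * [:- \<zeta> (h - 1), 1:] * [:- \<zeta> m, 1:] * [:- \<zeta> (h - m), 1:]"
    using complex_charpoly_double_rotation [OF lin dr] neg [of 1] neg [of m] m
    by (simp add: \<zeta>_def)
  have ord: "order (\<zeta> k) (complex_charpoly w) = count {#1, m, h - m, h - 1#} k" if "k < h" for k
  proof -
    have "order (\<zeta> k) (complex_charpoly w) = (if \<zeta> k = \<zeta> 1 then 1 else 0)
        + (if \<zeta> k = \<zeta> (h - 1) then 1 else 0) + (if \<zeta> k = \<zeta> m then 1 else 0)
        + (if \<zeta> k = \<zeta> (h - m) then 1 else 0)"
    proof -
      have ne: "[:- a, 1:] \<noteq> 0" for a :: complex by simp
      show ?thesis
        unfolding cp by (subst order_mult, intro no_zero_divisors ne)+ (simp only: order_linear_factor)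
    qed
    also have "\<dots> = count {#1, m, h - m, h - 1#} k"
      using m that by (simp add: inj)
    finally show ?thesis .
  qed
  show ?thesis
  proof (rule multiset_eqI)
    fix k
    have "count (exponents w) k
        = (\<Sum>j\<in>{0<..<h}. if k = j then order (\<zeta> j) (complex_charpoly w) else 0)"
      unfolding exponents_def h Let_def z_exp count_sum count_replicate_mset ..
    also have "\<dots> = (if k \<in> {0<..<h} then order (\<zeta> k) (complex_charpoly w) else 0)"
      by simp
    also have "\<dots> = count {#1, m, h - m, h - 1#} k"
      using m by (auto simp: ord)
    finally show "count (exponents w) k = count {#1, m, h - m, h - 1#} k" .
  qed
qed

section \<open>Trace and scalar part of a product of four reflections\<close>

lemma linear_reflection: "linear (reflection a)"
  by (rule linearI) (simp_all add: reflection_def inner_add_right algebra_simps add_divide_distrib)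

lemma inner_reflection: "reflection a x \<bullet> reflection a y = x \<bullet> y"
proof (cases "a = 0")
  case False
  define k where "k z = 2 * (a \<bullet> z) / (a \<bullet> a)" for z
  have k: "k z * (a \<bullet> a) = 2 * (a \<bullet> z)" for z
    using False by (simp add: k_def)
  have refl: "reflection a z = z - k z *\<^sub>R a" for z
    by (simp add: reflection_def k_def)
  have "reflection a x \<bullet> reflection a y
      = x \<bullet> y - k y * (a \<bullet> x) - k x * (a \<bullet> y) + k x * (k y * (a \<bullet> a))"
    unfolding refl by (simp add: inner_diff_left inner_diff_right inner_commute [of x a] algebra_simps)
  also have "\<dots> = x \<bullet> y - k y * (a \<bullet> x) + k x * (a \<bullet> y)"
    unfolding k by simp
  also have "k x * (a \<bullet> y) = k y * (a \<bullet> x)"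
    by (simp add: k_def)
  finally show ?thesis by simp
qed (simp add: reflection_def)

lemma linear_coxeter_element: "linear (coxeter_element as)"
proof (induction as)
  case Nil
  show ?case by (rule linearI) (simp_all add: coxeter_element_def)
next
  case (Cons a as)
  have "coxeter_element (a # as) = coxeter_element as \<circ> reflection a"
    by (simp add: coxeter_element_def)
  thus ?case by (simp only: linear_compose [OF linear_reflection Cons.IH])
qed

lemma inner_coxeter_element: "coxeter_element as x \<bullet> coxeter_element as y = x \<bullet> y"
  by (induction as arbitrary: x y) (simp_all add: coxeter_element_def inner_reflection)

text \<open>
  The coefficients are those of the successive reflections, by forward substitution: each reflection
  sees the vector already changed by the previous ones.
\<close>

lemma coxeter_element_apply4:
  fixes a b c d x :: "'a::euclidean_space"
  assumes unit: "a \<bullet> a = 1" "b \<bullet> b = 1" "c \<bullet> c = 1" "d \<bullet> d = 1"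
  defines "k\<^sub>1 \<equiv> 2 * (a \<bullet> x)"
  defines "k\<^sub>2 \<equiv> 2 * (b \<bullet> x) - 2 * (a \<bullet> b) * k\<^sub>1"
  defines "k\<^sub>3 \<equiv> 2 * (c \<bullet> x) - 2 * (a \<bullet> c) * k\<^sub>1 - 2 * (b \<bullet> c) * k\<^sub>2"
  defines "k\<^sub>4 \<equiv> 2 * (d \<bullet> x) - 2 * (a \<bullet> d) * k\<^sub>1 - 2 * (b \<bullet> d) * k\<^sub>2 - 2 * (c \<bullet> d) * k\<^sub>3"
  shows "coxeter_element [a, b, c, d] x = x - (k\<^sub>1 *\<^sub>R a + k\<^sub>2 *\<^sub>R b + k\<^sub>3 *\<^sub>R c + k\<^sub>4 *\<^sub>R d)"
proof -
  have "reflection a x = x - k\<^sub>1 *\<^sub>R a"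
    by (simp add: reflection_def unit k\<^sub>1_def)
  moreover have "reflection b (x - k\<^sub>1 *\<^sub>R a) = x - k\<^sub>1 *\<^sub>R a - k\<^sub>2 *\<^sub>R b"
    by (simp add: reflection_def unit k\<^sub>2_def inner_diff_right inner_commute [of b a] algebra_simps)
  moreover have "reflection c (x - k\<^sub>1 *\<^sub>R a - k\<^sub>2 *\<^sub>R b) = x - k\<^sub>1 *\<^sub>R a - k\<^sub>2 *\<^sub>R b - k\<^sub>3 *\<^sub>R c"
    by (simp add: reflection_def unit k\<^sub>3_def inner_diff_right inner_commute [of c a]
        inner_commute [of c b] algebra_simps)
  moreover have "reflection d (x - k\<^sub>1 *\<^sub>R a - k\<^sub>2 *\<^sub>R b - k\<^sub>3 *\<^sub>R c)
      = x - k\<^sub>1 *\<^sub>R a - k\<^sub>2 *\<^sub>R b - k\<^sub>3 *\<^sub>R c - k\<^sub>4 *\<^sub>R d"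
    by (simp add: reflection_def unit k\<^sub>4_def inner_diff_right inner_commute [of d a]
        inner_commute [of d b] inner_commute [of d c] algebra_simps)
  ultimately have "coxeter_element [a, b, c, d] x
      = x - k\<^sub>1 *\<^sub>R a - k\<^sub>2 *\<^sub>R b - k\<^sub>3 *\<^sub>R c - k\<^sub>4 *\<^sub>R d"
    by (simp add: coxeter_element_def)
  thus ?thesis by (simp add: algebra_simps)
qed

text \<open>
  The trace can be taken in any orthonormal basis. Its terms belong to the edges, triangles and one
  of the four-cycles of the complete graph on the four vectors.
\<close>

lemma trace_coxeter_element4:
  fixes a b c d :: "real ^ 4"
  assumes unit: "a \<bullet> a = 1" "b \<bullet> b = 1" "c \<bullet> c = 1" "d \<bullet> d = 1"
    and fr: "orthonormal4 u v p q"
  defines "w \<equiv> coxeter_element [a, b, c, d]"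
  shows "u \<bullet> w u + v \<bullet> w v + p \<bullet> w p + q \<bullet> w q =
    - 4 + 4 * ((a \<bullet> b)\<^sup>2 + (a \<bullet> c)\<^sup>2 + (a \<bullet> d)\<^sup>2 + (b \<bullet> c)\<^sup>2 + (b \<bullet> d)\<^sup>2 + (c \<bullet> d)\<^sup>2)
    - 8 * ((a \<bullet> b) * (b \<bullet> c) * (a \<bullet> c) + (a \<bullet> b) * (b \<bullet> d) * (a \<bullet> d)
         + (a \<bullet> c) * (c \<bullet> d) * (a \<bullet> d) + (b \<bullet> c) * (c \<bullet> d) * (b \<bullet> d))
    + 16 * ((a \<bullet> b) * (b \<bullet> c) * (c \<bullet> d) * (a \<bullet> d))"
proof -
  define S where "S x y = (u \<bullet> x) * (u \<bullet> y) + (v \<bullet> x) * (v \<bullet> y) + (p \<bullet> x) * (p \<bullet> y) + (q \<bullet> x) * (q \<bullet> y)" for x y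
  have S: "S x y = x \<bullet> y" for x y
    unfolding S_def by (rule orthonormal4_inner [OF fr, symmetric])
  have term_w: "f \<bullet> w f = f \<bullet> f
      - 2 * ((f \<bullet> a) * (f \<bullet> a) + (f \<bullet> b) * (f \<bullet> b) + (f \<bullet> c) * (f \<bullet> c) + (f \<bullet> d) * (f \<bullet> d))
      + 4 * ((a \<bullet> b) * ((f \<bullet> a) * (f \<bullet> b)) + (a \<bullet> c) * ((f \<bullet> a) * (f \<bullet> c)) + (a \<bullet> d) * ((f \<bullet> a) * (f \<bullet> d))
        + (b \<bullet> c) * ((f \<bullet> b) * (f \<bullet> c)) + (b \<bullet> d) * ((f \<bullet> b) * (f \<bullet> d)) + (c \<bullet> d) * ((f \<bullet> c) * (f \<bullet> d)))
      - 8 * ((a \<bullet> b) * (b \<bullet> c) * ((f \<bullet> a) * (f \<bullet> c)) + (a \<bullet> b) * (b \<bullet> d) * ((f \<bullet> a) * (f \<bullet> d))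
        + (a \<bullet> c) * (c \<bullet> d) * ((f \<bullet> a) * (f \<bullet> d)) + (b \<bullet> c) * (c \<bullet> d) * ((f \<bullet> b) * (f \<bullet> d)))
      + 16 * ((a \<bullet> b) * (b \<bullet> c) * (c \<bullet> d) * ((f \<bullet> a) * (f \<bullet> d)))" for f
    unfolding w_def coxeter_element_apply4 [OF unit]
    by (simp add: inner_diff_right inner_add_right inner_commute [of a f] inner_commute [of b f]
        inner_commute [of c f] inner_commute [of d f] algebra_simps)
  have "u \<bullet> w u + v \<bullet> w v + p \<bullet> w p + q \<bullet> w q = (u \<bullet> u + v \<bullet> v + p \<bullet> p + q \<bullet> q)
      - 2 * (S a a + S b b + S c c + S d d)
      + 4 * ((a \<bullet> b) * S a b + (a \<bullet> c) * S a c + (a \<bullet> d) * S a d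
        + (b \<bullet> c) * S b c + (b \<bullet> d) * S b d + (c \<bullet> d) * S c d)
      - 8 * ((a \<bullet> b) * (b \<bullet> c) * S a c + (a \<bullet> b) * (b \<bullet> d) * S a d
        + (a \<bullet> c) * (c \<bullet> d) * S a d + (b \<bullet> c) * (c \<bullet> d) * S b d)
      + 16 * ((a \<bullet> b) * (b \<bullet> c) * (c \<bullet> d) * S a d)"
    unfolding term_w S_def by (simp only: distrib_left)
  also have "u \<bullet> u + v \<bullet> v + p \<bullet> p + q \<bullet> q = 4"
    using fr by (simp add: orthonormal4_def)
  finally show ?thesis
    by (simp add: S unit power2_eq_square)
qed

text \<open>
  For a fixed vector the combination of the roots that \<open>w\<close> subtracts is zero, so by independence each
  coefficient is zero; by forward substitution the vector is orthogonal to all roots.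
\<close>

lemma coxeter_element_no_fixed_vector:
  fixes a b c d x :: "'a::euclidean_space"
  assumes indep: "independent {a, b, c, d}" and dist: "distinct [a, b, c, d]"
    and span: "span {a, b, c, d} = UNIV"
    and fixed: "coxeter_element [a, b, c, d] x = x"
  shows "x = 0"
proof -
  have dist': "b \<noteq> a" "c \<noteq> a" "d \<noteq> a" "c \<noteq> b" "d \<noteq> b" "d \<noteq> c"
    using dist by auto
  have "0 \<notin> {a, b, c, d}"
    using indep by (rule contrapos_nn) (rule dependent_zero)
  hence nz: "a \<noteq> 0" "b \<noteq> 0" "c \<noteq> 0" "d \<noteq> 0" by auto
  hence unit: "sgn a \<bullet> sgn a = 1" "sgn b \<bullet> sgn b = 1" "sgn c \<bullet> sgn c = 1" "sgn d \<bullet> sgn d = 1"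
    by (simp_all add: dot_square_norm norm_sgn)
  have zero: "k\<^sub>1 = 0 \<and> k\<^sub>2 = 0 \<and> k\<^sub>3 = 0 \<and> k\<^sub>4 = 0"
    if "k\<^sub>1 *\<^sub>R sgn a + k\<^sub>2 *\<^sub>R sgn b + k\<^sub>3 *\<^sub>R sgn c + k\<^sub>4 *\<^sub>R sgn d = 0" for k\<^sub>1 k\<^sub>2 k\<^sub>3 k\<^sub>4
  proof -
    define f where "f y = (if y = a then k\<^sub>1 else if y = b then k\<^sub>2 else if y = c then k\<^sub>3 else k\<^sub>4) / norm y" for y
    have "(\<Sum>y\<in>{a, b, c, d}. f y *\<^sub>R y) = 0"
      using dist dist' that by (simp add: f_def add.assoc sgn_div_norm divide_inverse)
    hence "f y = 0" if "y \<in> {a, b, c, d}" for y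
      using independentD [OF indep _ subset_refl _ that, of f] by simp
    hence "f a = 0" "f b = 0" "f c = 0" "f d = 0" by simp_all
    thus ?thesis using dist' nz by (simp add: f_def)
  qed
  have 0: "sgn a \<bullet> x = 0 \<and> sgn b \<bullet> x = 0 \<and> sgn c \<bullet> x = 0 \<and> sgn d \<bullet> x = 0"
  proof -
    define k\<^sub>1 where "k\<^sub>1 = 2 * (sgn a \<bullet> x)"
    define k\<^sub>2 where "k\<^sub>2 = 2 * (sgn b \<bullet> x) - 2 * (sgn a \<bullet> sgn b) * k\<^sub>1"
    define k\<^sub>3 where "k\<^sub>3 = 2 * (sgn c \<bullet> x) - 2 * (sgn a \<bullet> sgn c) * k\<^sub>1 - 2 * (sgn b \<bullet> sgn c) * k\<^sub>2"
    define k\<^sub>4 where "k\<^sub>4 = 2 * (sgn d \<bullet> x) - 2 * (sgn a \<bullet> sgn d) * k\<^sub>1 - 2 * (sgn b \<bullet> sgn d) * k\<^sub>2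
      - 2 * (sgn c \<bullet> sgn d) * k\<^sub>3"
    have "coxeter_element [sgn a, sgn b, sgn c, sgn d] x = x"
      using fixed by (simp add: coxeter_element_def reflection_sgn)
    hence "x = x - (k\<^sub>1 *\<^sub>R sgn a + k\<^sub>2 *\<^sub>R sgn b + k\<^sub>3 *\<^sub>R sgn c + k\<^sub>4 *\<^sub>R sgn d)"
      using coxeter_element_apply4 [OF unit, of x]
      by (simp only: k\<^sub>1_def k\<^sub>2_def k\<^sub>3_def k\<^sub>4_def)
    hence "k\<^sub>1 *\<^sub>R sgn a + k\<^sub>2 *\<^sub>R sgn b + k\<^sub>3 *\<^sub>R sgn c + k\<^sub>4 *\<^sub>R sgn d = 0"
      by (metis diff_eq_eq add_cancel_left_right)
    from zero [OF this] have "k\<^sub>1 = 0" "k\<^sub>2 = 0" "k\<^sub>3 = 0" "k\<^sub>4 = 0" by auto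
    thus ?thesis using k\<^sub>1_def k\<^sub>2_def k\<^sub>3_def k\<^sub>4_def by simp
  qed
  have "orthogonal x x"
    by (rule orthogonal_to_span [of x "{a, b, c, d}"])
      (use 0 nz in \<open>auto simp: span orthogonal_def inner_commute [of x] sgn_div_norm\<close>)
  thus ?thesis by (simp add: orthogonal_self)
qed

text \<open>
  Trace and scalar part, each computed once from the rotation angles and once from the Gram matrix.
  Only the square of the scalar part is available, as the versor is determined up to sign.
\<close>

lemma double_rotation_invariants:
  fixes a b c d :: "real ^ 4"
  assumes unit: "a \<bullet> a = 1" "b \<bullet> b = 1" "c \<bullet> c = 1" "d \<bullet> d = 1"
    and dr: "double_rotation (coxeter_element [a, b, c, d]) \<theta> \<phi> u v p q"
  shows "2 * cos \<theta> + 2 * cos \<phi> =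
    - 4 + 4 * ((a \<bullet> b)\<^sup>2 + (a \<bullet> c)\<^sup>2 + (a \<bullet> d)\<^sup>2 + (b \<bullet> c)\<^sup>2 + (b \<bullet> d)\<^sup>2 + (c \<bullet> d)\<^sup>2)
    - 8 * ((a \<bullet> b) * (b \<bullet> c) * (a \<bullet> c) + (a \<bullet> b) * (b \<bullet> d) * (a \<bullet> d)
         + (a \<bullet> c) * (c \<bullet> d) * (a \<bullet> d) + (b \<bullet> c) * (c \<bullet> d) * (b \<bullet> d))
    + 16 * ((a \<bullet> b) * (b \<bullet> c) * (c \<bullet> d) * (a \<bullet> d))"
    and "(1 + cos \<theta>) * (1 + cos \<phi>) =
      4 * ((a \<bullet> b) * (c \<bullet> d) - (a \<bullet> c) * (b \<bullet> d) + (a \<bullet> d) * (b \<bullet> c))\<^sup>2"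
proof -
  let ?w = "coxeter_element [a, b, c, d]"
  have fr: "orthonormal4 u v p q" using dr by (simp add: double_rotation_def)
  have "u \<bullet> ?w u + v \<bullet> ?w v + p \<bullet> ?w p + q \<bullet> ?w q = 2 * cos \<theta> + 2 * cos \<phi>"
  proof -
    have rot: "?w u = cos \<theta> *\<^sub>R u + sin \<theta> *\<^sub>R v" "?w v = cos \<theta> *\<^sub>R v - sin \<theta> *\<^sub>R u"
      "?w p = cos \<phi> *\<^sub>R p + sin \<phi> *\<^sub>R q" "?w q = cos \<phi> *\<^sub>R q - sin \<phi> *\<^sub>R p"
      using dr by (simp_all add: double_rotation_def)
    show ?thesis
      unfolding rot using fr
      by (simp add: orthonormal4_def inner_add_right inner_diff_right inner_commute [of v u] inner_commute [of q p])
  qed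
  with trace_coxeter_element4 [OF unit fr] show "2 * cos \<theta> + 2 * cos \<phi> =
    - 4 + 4 * ((a \<bullet> b)\<^sup>2 + (a \<bullet> c)\<^sup>2 + (a \<bullet> d)\<^sup>2 + (b \<bullet> c)\<^sup>2 + (b \<bullet> d)\<^sup>2 + (c \<bullet> d)\<^sup>2)
    - 8 * ((a \<bullet> b) * (b \<bullet> c) * (a \<bullet> c) + (a \<bullet> b) * (b \<bullet> d) * (a \<bullet> d)
         + (a \<bullet> c) * (c \<bullet> d) * (a \<bullet> d) + (b \<bullet> c) * (c \<bullet> d) * (b \<bullet> d))
    + 16 * ((a \<bullet> b) * (b \<bullet> c) * (c \<bullet> d) * (a \<bullet> d))" by simp
  let ?r = "half_rotation_roots \<theta> \<phi> u v p q"
  have len: "length ?r = 4" by (simp add: half_rotation_roots_def)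
  have "0 \<notin> set [a, b, c, d]" using unit by auto
  hence "versor ?r = versor [a, b, c, d] \<or> versor ?r = - versor [a, b, c, d]"
    by (intro versor_unique)
      (simp_all add: len zero_notin_half_rotation_roots [OF fr]
        coxeter_element_half_rotation_roots [OF linear_coxeter_element dr])
  hence "(blade_inner 1 (versor ?r))\<^sup>2 = (blade_inner 1 (versor [a, b, c, d]))\<^sup>2"
    using blade_inner_scaleR_right [of 1 "- 1" "versor [a, b, c, d]"] by auto
  moreover have "sgn a = a" "sgn b = b" "sgn c = c" "sgn d = d"
    using unit by (simp_all add: sgn_div_norm norm_eq_sqrt_inner)
  hence "versor [a, b, c, d] = cvec a * cvec b * cvec c * cvec d"
    by (simp add: versor_def mult.assoc)
  ultimately have "(cos (\<theta> / 2) * cos (\<phi> / 2))\<^sup>2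
      = ((a \<bullet> b) * (c \<bullet> d) - (a \<bullet> c) * (b \<bullet> d) + (a \<bullet> d) * (b \<bullet> c))\<^sup>2"
    by (simp only: scalar_part_half_rotation_roots [OF fr] blade_inner_one_vectors4)
  moreover have half: "1 + cos \<alpha> = 2 * (cos (\<alpha> / 2))\<^sup>2" for \<alpha> :: real
    using cos_double_cos [of "\<alpha> / 2"] by simp
  ultimately show "(1 + cos \<theta>) * (1 + cos \<phi>) =
      4 * ((a \<bullet> b) * (c \<bullet> d) - (a \<bullet> c) * (b \<bullet> d) + (a \<bullet> d) * (b \<bullet> c))\<^sup>2"
    unfolding half by (simp add: power_mult_distrib)
qed

section \<open>The rotation angles of the Coxeter elements\<close>

text \<open>
  The hypotheses on \<open>G\<close> hold for a path \<open>1 - 2 - 3 - 4\<close> and for a star with centre \<open>2\<close>, the two shapes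
  that occur. Such a graph has no cycle, and its only possible perfect matching pairs \<open>1\<close> with \<open>2\<close> and
  \<open>3\<close> with \<open>4\<close>. So the expressions in the trace and the scalar part do not depend on the order
  \<open>i, j, k, l\<close> of the nodes, except for the sign of the scalar part.
\<close>

lemma tree_diagram_invariants:
  fixes G :: "nat \<Rightarrow> nat \<Rightarrow> real"
  assumes sym: "\<And>i j. G j i = G i j"
    and tree: "G 1 3 = 0" "G 1 4 = 0" "G 2 4 * G 3 4 = 0"
    and perm: "distinct [i, j, k, l]" "{i, j, k, l} \<subseteq> {1..4}"
  shows "(G i j)\<^sup>2 + (G i k)\<^sup>2 + (G i l)\<^sup>2 + (G j k)\<^sup>2 + (G j l)\<^sup>2 + (G k l)\<^sup>2
      = (G 1 2)\<^sup>2 + (G 2 3)\<^sup>2 + (G 2 4)\<^sup>2 + (G 3 4)\<^sup>2" (is ?squares)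
    and "G i j * G j k * G i k + G i j * G j l * G i l + G i k * G k l * G i l + G j k * G k l * G j l = 0"
      (is ?triangles)
    and "G i j * G j k * G k l * G i l = 0" (is ?cycle)
    and "(G i j * G k l - G i k * G j l + G i l * G j k)\<^sup>2 = (G 1 2)\<^sup>2 * (G 3 4)\<^sup>2" (is ?pfaffian)
proof -
  have sym': "G 2 1 = G 1 2" "G 3 1 = G 1 3" "G 4 1 = G 1 4" "G 3 2 = G 2 3" "G 4 2 = G 2 4" "G 4 3 = G 3 4"
    by (rule sym)+
  have "i \<in> {1, 2, 3, 4}" "j \<in> {1, 2, 3, 4}" "k \<in> {1, 2, 3, 4}" "l \<in> {1, 2, 3, 4}"
    using perm(2) by auto
  moreover have "i \<noteq> j" "i \<noteq> k" "i \<noteq> l" "j \<noteq> k" "j \<noteq> l" "k \<noteq> l"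
    using perm(1) by auto
  moreover have "G 2 4 = 0 \<or> G 3 4 = 0" using tree(3) by simp
  ultimately have "?squares \<and> ?triangles \<and> ?cycle \<and> ?pfaffian"
    by (elim insertE emptyE disjE)
      (simp_all del: One_nat_def add: sym' tree(1,2) power_mult_distrib)
  thus ?squares ?triangles ?cycle ?pfaffian by blast+
qed

fun diagram_number :: "diagram \<Rightarrow> nat" where
  "diagram_number A4 = 5" | "diagram_number B4 = 8" | "diagram_number D4 = 6"
| "diagram_number F4 = 12" | "diagram_number H4 = 30"

fun second_exponent :: "diagram \<Rightarrow> nat" where
  "second_exponent A4 = 2" | "second_exponent B4 = 3" | "second_exponent D4 = 3"
| "second_exponent F4 = 5" | "second_exponent H4 = 11"

text \<open>
  The equation \<open>cos(3x) = - cos(2x)\<close> at \<open>x = \<pi>/5\<close> is cubic in \<open>cos x\<close>, with the spurious root \<open>- 1\<close>.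
\<close>

lemma cos_pi_fifth: "4 * (cos (pi / 5))\<^sup>2 = 2 * cos (pi / 5) + 1"
proof -
  let ?c = "cos (pi / 5)"
  have "cos (3 * (pi / 5)) = cos (pi - 2 * (pi / 5))" by (simp add: field_simps)
  also have "\<dots> = - cos (2 * (pi / 5))" by (rule cos_pi_minus)
  finally have "4 * ?c ^ 3 - 3 * ?c = - (2 * ?c\<^sup>2 - 1)"
    unfolding cos_treble_cos cos_double_cos .
  hence "(?c + 1) * (4 * ?c\<^sup>2 - (2 * ?c + 1)) = 0"
    by (simp add: algebra_simps power2_eq_square power3_eq_cube)
  moreover have "?c > 0" by (intro cos_gt_zero) auto
  ultimately show ?thesis by simp
qed

text \<open>
  The expected angles have the trace and the scalar part that the diagram prescribes. For \<open>H\<^sub>4\<close> the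
  cosines of \<open>\<theta>\<close> and \<open>\<phi>\<close> are not computed separately: only their sum and product are needed, and
  these involve just the multiples \<open>2\<pi>/5\<close>, \<open>4\<pi>/5\<close>, \<open>\<pi>/3\<close> and \<open>2\<pi>/3\<close>.
\<close>

lemma diagram_angles:
  fixes X
  defines "g \<equiv> \<lambda>i j. cos (pi / label X (i, j))"
    and "\<theta> \<equiv> 2 * pi / diagram_number X" and "\<phi> \<equiv> 2 * pi * second_exponent X / diagram_number X"
  shows "cos \<theta> + cos \<phi> = - 2 + 2 * ((g 1 2)\<^sup>2 + (g 2 3)\<^sup>2 + (g 2 4)\<^sup>2 + (g 3 4)\<^sup>2)" (is ?sum)
    and "(1 + cos \<theta>) * (1 + cos \<phi>) = 4 * ((g 1 2)\<^sup>2 * (g 3 4)\<^sup>2)" (is ?prod)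
proof -
  define c where "c = cos (pi / 5)"
  have c: "c * c = c / 2 + 1 / 4"
    using cos_pi_fifth by (simp add: c_def power2_eq_square)
  have c2: "cos (2 * (pi / 5)) = c - 1 / 2"
    unfolding cos_double_cos c_def [symmetric] power2_eq_square c by simp
  have c4: "cos (pi - pi / 5) = - c"
    unfolding c_def by (rule cos_pi_minus)
  have "?sum \<and> ?prod"
  proof (cases X)
    case A4
    have "\<theta> = 2 * (pi / 5)" "\<phi> = pi - pi / 5"
      by (simp_all add: \<theta>_def \<phi>_def A4)
    hence ang: "cos \<theta> = c - 1 / 2" "cos \<phi> = - c"
      by (simp_all only: c2 c4)
    have g: "g 1 2 = 1 / 2" "g 2 3 = 1 / 2" "g 2 4 = 0" "g 3 4 = 1 / 2"
      by (simp_all add: g_def A4 cos_60)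
    show ?thesis
      unfolding g ang by (simp add: power2_eq_square algebra_simps c) (simp add: field_simps)
  next
    case B4
    have "\<theta> = pi / 4" "\<phi> = pi - pi / 4"
      by (simp_all add: \<theta>_def \<phi>_def B4)
    hence ang: "cos \<theta> = sqrt 2 / 2" "cos \<phi> = - (sqrt 2 / 2)"
      by (simp_all only: cos_45 cos_pi_minus)
    have g: "g 1 2 = 1 / 2" "g 2 3 = 1 / 2" "g 2 4 = 0" "g 3 4 = sqrt 2 / 2"
      by (simp_all add: g_def B4 cos_60 cos_45)
    show ?thesis
      unfolding g ang by (simp add: power2_eq_square algebra_simps)
  next
    case D4
    have "\<theta> = pi / 3" "\<phi> = pi"
      by (simp_all add: \<theta>_def \<phi>_def D4)
    hence ang: "cos \<theta> = 1 / 2" "cos \<phi> = - 1"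
      by (simp_all only: cos_60 cos_pi)
    have g: "g 1 2 = 1 / 2" "g 2 3 = 1 / 2" "g 2 4 = 1 / 2" "g 3 4 = 0"
      by (simp_all add: g_def D4 cos_60)
    show ?thesis
      unfolding g ang by (simp add: power2_eq_square)
  next
    case F4
    have "\<theta> = pi / 6" "\<phi> = pi - pi / 6"
      by (simp_all add: \<theta>_def \<phi>_def F4)
    hence ang: "cos \<theta> = sqrt 3 / 2" "cos \<phi> = - (sqrt 3 / 2)"
      by (simp_all only: cos_30 cos_pi_minus)
    have g: "g 1 2 = 1 / 2" "g 2 3 = sqrt 2 / 2" "g 2 4 = 0" "g 3 4 = 1 / 2"
      by (simp_all add: g_def F4 cos_60 cos_45)
    show ?thesis
      unfolding g ang by (simp add: power2_eq_square algebra_simps)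
  next
    case H4
    have half: "(\<phi> + \<theta>) / 2 = 2 * (pi / 5)" "(\<phi> - \<theta>) / 2 = pi / 3"
      and whole: "\<phi> + \<theta> = pi - pi / 5" "\<phi> - \<theta> = pi - pi / 3"
      by (simp_all add: \<theta>_def \<phi>_def H4 field_simps)
    have sum: "cos \<phi> + cos \<theta> = c - 1 / 2"
      unfolding cos_plus_cos half c2 cos_60 by simp
    have prod: "cos \<phi> * cos \<theta> = - c / 2 - 1 / 4"
      unfolding cos_times_cos whole cos_pi_minus cos_60 c_def [symmetric] by (simp add: field_simps)
    have g: "g 1 2 = 1 / 2" "g 2 3 = 1 / 2" "g 2 4 = 0" "g 3 4 = c"
      by (simp_all add: g_def H4 cos_60 c_def)
    have "(1 + cos \<theta>) * (1 + cos \<phi>) = 1 + (cos \<phi> + cos \<theta>) + cos \<phi> * cos \<theta>"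
      by (simp add: algebra_simps)
    with sum prod show ?thesis
      unfolding g by (simp add: power2_eq_square c add.commute)
  qed
  thus ?sum ?prod by blast+
qed

lemma angle_pair_unique:
  fixes \<theta> \<phi> \<alpha> \<beta> :: real
  assumes "0 \<le> \<theta>" "\<theta> \<le> \<phi>" "\<phi> \<le> pi" "0 \<le> \<alpha>" "\<alpha> \<le> \<beta>" "\<beta> \<le> pi"
    and sum: "cos \<theta> + cos \<phi> = cos \<alpha> + cos \<beta>"
    and prod: "(1 + cos \<theta>) * (1 + cos \<phi>) = (1 + cos \<alpha>) * (1 + cos \<beta>)"
  shows "\<theta> = \<alpha>" "\<phi> = \<beta>"
proof -
  have ord: "cos \<phi> \<le> cos \<theta>" "cos \<beta> \<le> cos \<alpha>"
    using assms by (simp_all add: cos_mono_le_eq)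
  have "(cos \<theta> - cos \<alpha>) * (cos \<theta> - cos \<beta>) = 0"
    using sum prod by algebra
  hence "cos \<theta> = cos \<alpha> \<or> cos \<theta> = cos \<beta>" by simp
  hence "cos \<theta> = cos \<alpha> \<and> cos \<phi> = cos \<beta>" using ord sum by auto
  thus "\<theta> = \<alpha>" "\<phi> = \<beta>" using assms by (simp_all add: cos_inj_pi)
qed

text \<open>
  The extremal construction orders the angles as \<open>0 < \<theta> \<le> \<phi> \<le> \<pi>\<close>, and the expected angles are ordered
  alike. So equality of the sum and product of the cosines identifies them.
\<close>

lemma coxeter_element_double_rotation:
  assumes simple: "independent \<Delta>" and diag: "has_diagram \<Delta> X"
    and as: "distinct as" "set as = \<Delta>"
  obtains u v p q where "double_rotation (coxeter_element as) (2 * pi / diagram_number X)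
    (2 * pi * second_exponent X / diagram_number X) u v p q"
proof -
  obtain g where g: "bij_betw g {1..4} \<Delta>"
    and g_label: "\<And>i j. 1 \<le> i \<Longrightarrow> i < j \<Longrightarrow> j \<le> 4 \<Longrightarrow> sgn (g i) \<bullet> sgn (g j) = - cos (pi / label X (i, j))"
    using diag unfolding has_diagram_def by blast
  have "card \<Delta> = 4" using bij_betw_same_card [OF g] by simp
  hence "length as = 4" using as distinct_card by metis
  then obtain a b c d where abcd: "as = [a, b, c, d]"
    by (auto simp: numeral_eq_Suc length_Suc_conv)
  have nz: "0 \<notin> \<Delta>" using simple by (rule contrapos_nn) (rule dependent_zero)
  have "DIM(real ^ 4) \<le> card \<Delta>" by (simp add: \<open>card \<Delta> = 4\<close>)
  hence span: "span \<Delta> = UNIV"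
    using card_ge_dim_independent [OF subset_UNIV simple] by auto
  have "\<exists>i\<in>{1..4}. x = g i" if "x \<in> \<Delta>" for x
    using g that by (auto simp: bij_betw_def)
  hence "\<exists>i\<in>{1..4}. a = g i" "\<exists>i\<in>{1..4}. b = g i" "\<exists>i\<in>{1..4}. c = g i" "\<exists>i\<in>{1..4}. d = g i"
    using as(2) abcd by auto
  then obtain i j k l where ijkl: "a = g i" "b = g j" "c = g k" "d = g l" "{i, j, k, l} \<subseteq> {1..4}"
    by auto
  have dist: "distinct [i, j, k, l]"
    using as(1) unfolding abcd ijkl by auto
  define G where "G i j = sgn (g i) \<bullet> sgn (g j)" for i j
  have G: "G i j = - cos (pi / label X (i, j))" if "1 \<le> i" "i < j" "j \<le> 4" for i j
    unfolding G_def using that by (rule g_label)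
  have sym: "G j i = G i j" for i j by (simp add: G_def inner_commute)
  have tree: "G 1 3 = 0" "G 1 4 = 0" "G 2 4 * G 3 4 = 0"
    by (cases X; simp add: G)+
  note inv = tree_diagram_invariants [of G, OF sym tree dist ijkl(5)]
  have unit: "sgn x \<bullet> sgn x = 1" if "x \<in> \<Delta>" for x
    using that nz by (auto simp: dot_square_norm norm_sgn)
  have units: "sgn a \<bullet> sgn a = 1" "sgn b \<bullet> sgn b = 1" "sgn c \<bullet> sgn c = 1" "sgn d \<bullet> sgn d = 1"
    using as(2) abcd by (auto intro: unit)
  have sgns: "coxeter_element as = coxeter_element [sgn a, sgn b, sgn c, sgn d]"
    by (simp add: coxeter_element_def abcd reflection_sgn)
  let ?w = "coxeter_element as"
  have fix0: "x = 0" if "?w x = x" for x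
  proof (rule coxeter_element_no_fixed_vector)
    have \<Delta>: "{a, b, c, d} = \<Delta>" using as(2) unfolding abcd by simp
    show "independent {a, b, c, d}" "span {a, b, c, d} = UNIV"
      unfolding \<Delta> by (rule simple span)+
    show "distinct [a, b, c, d]" "coxeter_element [a, b, c, d] x = x"
      using as(1) that unfolding abcd .
  qed
  obtain u v p q \<theta> \<phi> where dr: "double_rotation ?w \<theta> \<phi> u v p q"
    and ang: "0 < \<theta>" "\<theta> \<le> \<phi>" "\<phi> \<le> pi"
    using double_rotation_exists [OF linear_coxeter_element inner_coxeter_element fix0] .
  note dinv = double_rotation_invariants [OF units dr [unfolded sgns],
      unfolded ijkl(1-4), folded G_def, unfolded inv]
  let ?\<alpha> = "2 * pi / diagram_number X" and ?\<beta> = "2 * pi * second_exponent X / diagram_number X"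
  have "cos \<theta> + cos \<phi> = cos ?\<alpha> + cos ?\<beta>"
    using dinv(1) by (simp add: diagram_angles(1) G)
  moreover have "(1 + cos \<theta>) * (1 + cos \<phi>) = (1 + cos ?\<alpha>) * (1 + cos ?\<beta>)"
    using dinv(2) by (simp add: diagram_angles(2) G)
  moreover have "0 \<le> ?\<alpha>" "?\<alpha> \<le> ?\<beta>" "?\<beta> \<le> pi"
    by (cases X; simp add: field_simps)+
  ultimately have "\<theta> = ?\<alpha>" "\<phi> = ?\<beta>"
    using angle_pair_unique [of \<theta> \<phi> ?\<alpha> ?\<beta>] ang by auto
  with dr that show ?thesis by blast
qed

section \<open>The Coxeter plane and the factorisation\<close>

lemma coxeter_plane_double_rotation:
  fixes h m :: nat
  assumes lin: "linear w" and dr: "double_rotation w (2 * pi / h) (2 * pi * m / h) u v p q"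
    and hm: "1 < m" "2 * m \<le> h"
  shows "coxeter_plane w P \<longleftrightarrow> P = span {u, v}"
proof -
  have h: "coxeter_number w = h" using hm by (intro coxeter_number_double_rotation [OF lin dr]) simp
  have "2 * pi / h < 2 * pi * m / h" "2 * pi * m / h \<le> pi"
    using hm by (simp_all add: field_simps flip: of_nat_mult)
  hence ne: "cos (2 * pi / h) \<noteq> cos (2 * pi * m / h)"
    using cos_monotone_0_pi [of "2 * pi / h" "2 * pi * m / h"] by simp
  have "orthonormal_basis2 u v (span {u, v})"
    using dr by (auto simp: double_rotation_def orthonormal4_def orthonormal_basis2_def norm_eq_1)
  hence rot: "rotates_plane w (2 * pi / h) (span {u, v})"
    using dr unfolding rotates_plane_def double_rotation_def by (intro exI [of _ u] exI [of _ v]) simp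
  show ?thesis
    unfolding coxeter_plane_def h
  proof
    show "P = span {u, v}" if "rotates_plane w (2 * pi / h) P"
      using rotates_plane_unique [OF lin dr ne that] .
    show "rotates_plane w (2 * pi / h) P" if "P = span {u, v}"
      unfolding that by (rule rot)
  qed
qed

text \<open>
  Three independent signs arise: of the versor relative to \<open>half_rotation_roots\<close>, of \<open>B\<close> relative to the
  orientation of \<open>u, v\<close>, and of the pseudoscalar times \<open>uv\<close> relative to the orientation of \<open>p, q\<close>. The
  exponent of the second factor carries the product of the last two.
\<close>

lemma versor_factorises:
  assumes as: "0 \<notin> set as" "even (length as)"
    and dr: "double_rotation (coxeter_element as) \<theta> \<phi> u v p q"
    and B: "unit_bivector (span {u, v}) B"
  shows "factorises (versor as) B (\<theta> / 2) (\<phi> / 2)"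
proof -
  have fr: "orthonormal4 u v p q" using dr by (simp add: double_rotation_def)
  let ?r = "half_rotation_roots \<theta> \<phi> u v p q"
  have signs: "\<exists>\<epsilon>\<in>{1, - 1}. y = \<epsilon> *\<^sub>R x" if "y = x \<or> y = - x" for x y :: "4 clifford"
    using that by auto
  have "even (length ?r)" by (simp add: half_rotation_roots_def)
  hence "versor as = versor ?r \<or> versor as = - versor ?r"
    using as by (intro versor_unique)
      (simp_all add: zero_notin_half_rotation_roots [OF fr]
        coxeter_element_half_rotation_roots [OF linear_coxeter_element dr])
  then obtain \<epsilon> where e: "\<epsilon> \<in> {1, - 1 :: real}" "versor as = \<epsilon> *\<^sub>R versor ?r"
    using signs by blast
  have "unit_bivector (span {u, v}) (cvec u * cvec v)"
    using fr by (auto simp: unit_bivector_def orthonormal_basis2_def orthonormal4_def norm_eq_1)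
  then obtain \<epsilon>\<^sub>1 where e1: "\<epsilon>\<^sub>1 \<in> {1, - 1 :: real}" "cvec u * cvec v = \<epsilon>\<^sub>1 *\<^sub>R B"
    using unit_bivector_unique [OF _ B] signs by blast
  have "cvec p * cvec q = pseudoscalar * (cvec u * cvec v)
      \<or> cvec p * cvec q = - (pseudoscalar * (cvec u * cvec v))"
    using pseudoscalar_mult_bivector [OF fr] by auto
  then obtain \<delta> where d: "\<delta> \<in> {1, - 1 :: real}" "cvec p * cvec q = \<delta> *\<^sub>R (pseudoscalar * (cvec u * cvec v))"
    using signs by blast
  have "versor as = \<epsilon> *\<^sub>R (exp ((\<epsilon>\<^sub>1 * (\<theta> / 2)) *\<^sub>R B)
      * exp (((\<delta> * \<epsilon>\<^sub>1) * (\<phi> / 2)) *\<^sub>R (pseudoscalar * B)))"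
    unfolding e(2) versor_half_rotation_roots [OF fr] d(2) unfolding e1(2)
    by (simp add: mult_ac)
  moreover have "\<delta> * \<epsilon>\<^sub>1 \<in> {1, - 1}" using d(1) e1(1) by auto
  ultimately show ?thesis unfolding factorises_def using e(1) e1(1) by blast
qed

theorem mainTheorem5:
  fixes \<Phi> \<Delta> :: "(real ^ 4) set" and as :: "(real ^ 4) list"
  assumes "root_system \<Phi>" and "simple_system \<Phi> \<Delta>"
    and "has_diagram \<Delta> X"
    and "distinct as" and "set as = \<Delta>"
  defines "w \<equiv> coxeter_element as" and "W \<equiv> versor as"
  shows "(\<exists>!P. coxeter_plane w P) \<and>
    (\<forall>P B. coxeter_plane w P \<and> unit_bivector P B \<longrightarrow> unit_bivector (P\<^sup>\<bottom>) (pseudoscalar * B)) \<and>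
    (X = A4 \<longrightarrow> coxeter_number w = 5 \<and> exponents w = {#1, 2, 3, 4#} \<and>
      (\<forall>B. coxeter_bivector w B \<longrightarrow> factorises W B (pi / 5) (2 * pi / 5))) \<and>
    (X = B4 \<longrightarrow> coxeter_number w = 8 \<and> exponents w = {#1, 3, 5, 7#} \<and>
      (\<forall>B. coxeter_bivector w B \<longrightarrow> factorises W B (pi / 8) (3 * pi / 8))) \<and>
    (X = D4 \<longrightarrow> coxeter_number w = 6 \<and> exponents w = {#1, 3, 3, 5#} \<and>
      (\<forall>B. coxeter_bivector w B \<longrightarrow> factorises W B (pi / 6) (pi / 2))) \<and>
    (X = F4 \<longrightarrow> coxeter_number w = 12 \<and> exponents w = {#1, 5, 7, 11#} \<and>
      (\<forall>B. coxeter_bivector w B \<longrightarrow> factorises W B (pi / 12) (5 * pi / 12))) \<and>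
    (X = H4 \<longrightarrow> coxeter_number w = 30 \<and> exponents w = {#1, 11, 19, 29#} \<and>
      (\<forall>B. coxeter_bivector w B \<longrightarrow> factorises W B (pi / 30) (11 * pi / 30)))"
proof -
  let ?h = "diagram_number X" and ?m = "second_exponent X"
  have indep: "independent \<Delta>" using assms(2) by (simp add: simple_system_def)
  obtain u v p q where dr: "double_rotation w (2 * pi / ?h) (2 * pi * ?m / ?h) u v p q"
    unfolding w_def using coxeter_element_double_rotation [OF indep assms(3-5)] .
  have lin: "linear w" unfolding w_def by (rule linear_coxeter_element)
  have hm: "1 < ?m" "2 * ?m \<le> ?h" by (cases X; simp)+
  have plane: "coxeter_plane w P \<longleftrightarrow> P = span {u, v}" for P
    by (rule coxeter_plane_double_rotation [OF lin dr hm])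
  have h: "coxeter_number w = ?h"
    using hm by (intro coxeter_number_double_rotation [OF lin dr]) simp
  have exps: "exponents w = {#1, ?m, ?h - ?m, ?h - 1#}"
    using hm by (intro exponents_double_rotation [OF lin dr]) simp_all
  have fact: "factorises W B (pi / ?h) (pi * ?m / ?h)" if "coxeter_bivector w B" for B
  proof -
    have "0 \<notin> set as"
      unfolding assms(5) using indep by (rule contrapos_nn) (rule dependent_zero)
    moreover have "even (length as)"
    proof -
      have "card \<Delta> = 4"
        using assms(3) bij_betw_same_card by (fastforce simp: has_diagram_def)
      thus ?thesis using assms(4,5) distinct_card [of as] by simp
    qed
    moreover have "unit_bivector (span {u, v}) B"
      using that by (simp add: coxeter_bivector_def plane)
    ultimately have "factorises W B (2 * pi / ?h / 2) (2 * pi * ?m / ?h / 2)"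
      unfolding W_def using dr [unfolded w_def] by (intro versor_factorises)
    thus ?thesis by simp
  qed
  have "\<exists>!P. coxeter_plane w P" by (simp add: plane)
  moreover have "\<forall>P B. coxeter_plane w P \<and> unit_bivector P B \<longrightarrow> unit_bivector (P\<^sup>\<bottom>) (pseudoscalar * B)"
    by (simp add: unit_bivector_orthogonal_plane)
  ultimately show ?thesis
    using h exps fact by (cases X) (simp_all add: mult.commute)
qed

end
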